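(* Let $K\ge 2$, $n\ge 1$, let $\pi$ be any probability distribution on $[K]^n$, and let $\xi\in[0,n]$. Let $P_{\mathrm{MG}}$, $P_{\mathrm{R}}$ and $P_{\mathrm{NR}}$ be the Markov kernels defined in the context. Then for every $g:[K]^n\to\mathbb{R}$, \[ \mathrm{Var}(g,P_{\mathrm{NR}})\;\le\;\mathrm{Var}(g,P_{\mathrm{R}})\;\le\; c(K)\,\mathrm{Var}(g,P_{\mathrm{MG}})+\bigl[c(K)-1\bigr]\mathrm{Var}_\pi(g),\qquad c(K)=2(K-1), \] where in $\mathrm{Var}(g,P_{\mathrm{NR}})$ the function $g$ is regarded as the function $(c,v)\mapsto g(c)$ on the extended space, and $\mathrm{Var}_\pi(g)$ is the variance of $g(X)$ for $X\sim\pi$.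
   Context: Notation: $[K]=\{1,\dots,K\}$; for $c=(c_1,\dots,c_n)\in[K]^n$, $n_k(c)=\#\{i:c_i=k\}$; $c_{-i}$ is $c$ with the $i$-th entry removed and $(c_{-i},k)$ is $c$ with $c_i$ replaced by $k$; $\pi(c_i=k\mid c_{-i})=\pi((c_{-i},k))/\sum_{j\in[K]}\pi((c_{-i},j))$. Let $\mathcal{K}=\{(k,k')\in[K]^2:k<k'\}$ and, for $c\in[K]^n$, $p_c(k,k')=\frac{n_k(c)+n_{k'}(c)}{(K-1)n}$ for $(k,k')\in\mathcal{K}$ (a probability distribution on $\mathcal{K}$). For $c$ in the support of $\pi$, $i$ with $c_i=k_-$ and $k_+\neq k_-$, set \[ r(c,i,k_-,k_+)=\frac{n_{k_-}(c)}{n_{k_+}(c)+1}\cdot\frac{\pi(c_i=k_+\mid c_{-i})}{\pi(c_i=k_-\mid c_{-i})}. \] Marginal Gibbs kernel $P_{\mathrm{MG}}$ on $[K]^n$: from $c$, pick $i$ uniformly in $[n]$ and resample $c_i\sim\pi(c_i=\cdot\mid c_{-i})$, keeping $c_{-i}$; i.e. $P_{\mathrm{MG}}(c,c')=\frac1n\sum_{i=1}^n \mathbb 1(c'_{-i}=c_{-i})\pi(c_i=c'_i\mid c_{-i})$. Kernel $P_{\mathrm{R}}$ on $[K]^n$: from $c$, sample $(k,k')\sim p_c$; set $(k_-,k_+)=(k,k')$ or $(k',k)$ with probability $1/2$ each; if $n_{k_-}(c)=0$ set $c'=c$; otherwise pick $i$ uniformly from $\{i':c_{i'}=k_-\}$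 and set $c'=(c_{-i},k_+)$ with probability $\min\{1,r(c,i,k_-,k_+)\}$, else $c'=c$. Kernel $P_{\mathrm{NR}}$ on $[K]^n\times\{-1,+1\}^{\mathcal{K}}$ (velocity $v=(v_{k,k'})_{(k,k')\in\mathcal K}$), with refresh parameter $\xi$: from $(c,v)$, sample $(k,k')\sim p_c$ and then apply the kernel $\tilde P_{k,k'}$: (1) with probability $\xi/n$ replace $v_{k,k'}$ by $-v_{k,k'}$; (2) set $(k_-,k_+)=(k,k')$ if $v_{k,k'}=+1$ and $(k_-,k_+)=(k',k)$ if $v_{k,k'}=-1$; (3) if $n_{k_-}(c)=0$, set $c'=c$ and $v'$ equal to $v$ with component $v_{k,k'}$ negated; otherwise pick $i$ uniformly from $\{i':c_{i'}=k_-\}$ and with probability $\min\{1,r(c,i,k_-,k_+)\}$ set $(c',v')=((c_{-i},k_+),v)$, else set $c'=c$ and $v'$ equal to $v$ with $v_{k,k'}$ negated; (4) with probability $\xi/n$ negate $v'_{k,k'}$. $P_{\mathrm{NR}}$ has invariant distribution $\tilde\pi(c,v)=\pi(c)2^{-K(K-1)/2}$. Asymptotic variance: for a kernel $P$ with invariant distribution $\mu$ and a Markov chain $(X_t)$ with kernel $P$ and $X_0\sim\mu$, $\mathrm{Var}(g,P)=\lim_{T\to\infty}T\,\mathrm{Var}\bigl(\frac1T\sum_{t=1}^T g(X_t)\bigr)=\mathrm{Var}_\mu(g)+2\sum_{t\ge1}\mathrm{Cov}(g(X_0),g(X_t))$, with values in $[0,\infty]$. *)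

theory Defs
  imports Complex_Main "HOL-Library.FuncSet" "HOL-Library.Extended_Real"
begin

definition paths :: "'s set \<Rightarrow> nat \<Rightarrow> 's list set" where
  "paths S T = {xs. set xs \<subseteq> S \<and> length xs = Suc T}"

definition path_prob :: "('s \<Rightarrow> real) \<Rightarrow> ('s \<Rightarrow> 's \<Rightarrow> real) \<Rightarrow> 's list \<Rightarrow> real" where
  "path_prob mu P xs = mu (xs ! 0) * (\<Prod>t<length xs - 1. P (xs ! t) (xs ! Suc t))"

definition erg_avg :: "('s \<Rightarrow> real) \<Rightarrow> nat \<Rightarrow> 's list \<Rightarrow> real" where
  "erg_avg g T xs = (1 / real T) * (\<Sum>t\<in>{1..T}. g (xs ! t))"

definition var_avg :: "'s set \<Rightarrow> ('s \<Rightarrow> real) \<Rightarrow> ('s \<Rightarrow> 's \<Rightarrow> real) \<Rightarrow> ('s \<Rightarrow> real) \<Rightarrow> nat \<Rightarrow> real" where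
  "var_avg S mu P g T =
     (\<Sum>xs\<in>paths S T. path_prob mu P xs * (erg_avg g T xs)\<^sup>2)
     - (\<Sum>xs\<in>paths S T. path_prob mu P xs * erg_avg g T xs)\<^sup>2"

definition asym_var :: "'s set \<Rightarrow> ('s \<Rightarrow> real) \<Rightarrow> ('s \<Rightarrow> 's \<Rightarrow> real) \<Rightarrow> ('s \<Rightarrow> real) \<Rightarrow> ereal" where
  "asym_var S mu P g = lim (\<lambda>T. ereal (real T * var_avg S mu P g T))"

definition var_dist :: "'s set \<Rightarrow> ('s \<Rightarrow> real) \<Rightarrow> ('s \<Rightarrow> real) \<Rightarrow> real" where
  "var_dist S mu g = (\<Sum>x\<in>S. mu x * (g x)\<^sup>2) - (\<Sum>x\<in>S. mu x * g x)\<^sup>2"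

type_synonym config = "nat \<Rightarrow> nat"
type_synonym velocity = "nat \<times> nat \<Rightarrow> int"

definition configs :: "nat \<Rightarrow> nat \<Rightarrow> config set" where
  "configs K n = PiE {1..n} (\<lambda>_. {1..K})"

definition Kpairs :: "nat \<Rightarrow> (nat \<times> nat) set" where
  "Kpairs K = {(k, k'). 1 \<le> k \<and> k < k' \<and> k' \<le> K}"

definition velocities :: "nat \<Rightarrow> velocity set" where
  "velocities K = PiE (Kpairs K) (\<lambda>_. {-1, 1})"

definition ncount :: "nat \<Rightarrow> config \<Rightarrow> nat \<Rightarrow> nat" where
  "ncount n c k = card {i \<in> {1..n}. c i = k}"

text \<open>pd(c_i = k | c_{-i}); (c_{-i},k) is c(i := k).\<close>
definition cond :: "nat \<Rightarrow> (config \<Rightarrow> real) \<Rightarrow> config \<Rightarrow> nat \<Rightarrow> nat \<Rightarrow> real" where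
  "cond K pd c i k = pd (c(i := k)) / (\<Sum>j\<in>{1..K}. pd (c(i := j)))"

definition pc :: "nat \<Rightarrow> nat \<Rightarrow> config \<Rightarrow> nat \<Rightarrow> nat \<Rightarrow> real" where
  "pc K n c k k' = real (ncount n c k + ncount n c k') / (real (K - 1) * real n)"

definition ratio :: "nat \<Rightarrow> nat \<Rightarrow> (config \<Rightarrow> real) \<Rightarrow> config \<Rightarrow> nat \<Rightarrow> nat \<Rightarrow> nat \<Rightarrow> real" where
  "ratio K n pd c i km kp =
     real (ncount n c km) / real (ncount n c kp + 1) * (cond K pd c i kp / cond K pd c i km)"

definition acc :: "nat \<Rightarrow> nat \<Rightarrow> (config \<Rightarrow> real) \<Rightarrow> config \<Rightarrow> nat \<Rightarrow> nat \<Rightarrow> nat \<Rightarrow> real" where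
  "acc K n pd c i km kp = min 1 (ratio K n pd c i km kp)"

definition ind :: "bool \<Rightarrow> real" where
  "ind b = (if b then 1 else 0)"

definition P_MG :: "nat \<Rightarrow> nat \<Rightarrow> (config \<Rightarrow> real) \<Rightarrow> config \<Rightarrow> config \<Rightarrow> real" where
  "P_MG K n pd c c' =
     (1 / real n) * (\<Sum>i\<in>{1..n}. ind (c' = c(i := c' i)) * cond K pd c i (c' i))"

definition R_step :: "nat \<Rightarrow> nat \<Rightarrow> (config \<Rightarrow> real) \<Rightarrow> config \<Rightarrow> nat \<Rightarrow> nat \<Rightarrow> config \<Rightarrow> real" where
  "R_step K n pd c km kp c' =
     (if ncount n c km = 0 then ind (c' = c)
      else (\<Sum>i\<in>{i \<in> {1..n}. c i = km}.
              (1 / real (ncount n c km)) *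
              (acc K n pd c i km kp * ind (c' = c(i := kp))
               + (1 - acc K n pd c i km kp) * ind (c' = c))))"

definition P_R :: "nat \<Rightarrow> nat \<Rightarrow> (config \<Rightarrow> real) \<Rightarrow> config \<Rightarrow> config \<Rightarrow> real" where
  "P_R K n pd c c' =
     (\<Sum>(k, k')\<in>Kpairs K. pc K n c k k' *
        ((1/2) * R_step K n pd c k k' c' + (1/2) * R_step K n pd c k' k c'))"

definition vflip :: "nat \<times> nat \<Rightarrow> velocity \<Rightarrow> velocity" where
  "vflip p v = v(p := - v p)"

definition flip_kernel :: "nat \<times> nat \<Rightarrow> real \<Rightarrow> velocity \<Rightarrow> velocity \<Rightarrow> real" where
  "flip_kernel p q v w = (1 - q) * ind (w = v) + q * ind (w = vflip p v)"

definition NR_core :: "nat \<Rightarrow> nat \<Rightarrow> (config \<Rightarrow> real) \<Rightarrow> nat \<Rightarrow> nat \<Rightarrow>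
    config \<times> velocity \<Rightarrow> config \<times> velocity \<Rightarrow> real" where
  "NR_core K n pd k k' s s' =
     (let c = fst s; v = snd s; c' = fst s'; v' = snd s';
          km = (if v (k, k') = 1 then k else k');
          kp = (if v (k, k') = 1 then k' else k)
      in if ncount n c km = 0 then ind (c' = c \<and> v' = vflip (k, k') v)
         else (\<Sum>i\<in>{i \<in> {1..n}. c i = km}.
                 (1 / real (ncount n c km)) *
                 (acc K n pd c i km kp * ind (c' = c(i := kp) \<and> v' = v)
                  + (1 - acc K n pd c i km kp) * ind (c' = c \<and> v' = vflip (k, k') v))))"

definition P_tilde :: "nat \<Rightarrow> nat \<Rightarrow> (config \<Rightarrow> real) \<Rightarrow> real \<Rightarrow> nat \<Rightarrow> nat \<Rightarrow>
    config \<times> velocity \<Rightarrow> config \<times> velocity \<Rightarrow> real" where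
  "P_tilde K n pd xi k k' s s' =
     (\<Sum>w1\<in>velocities K. \<Sum>w2\<in>velocities K.
        flip_kernel (k, k') (xi / real n) (snd s) w1
        * NR_core K n pd k k' (fst s, w1) (fst s', w2)
        * flip_kernel (k, k') (xi / real n) w2 (snd s'))"

definition P_NR :: "nat \<Rightarrow> nat \<Rightarrow> (config \<Rightarrow> real) \<Rightarrow> real \<Rightarrow>
    config \<times> velocity \<Rightarrow> config \<times> velocity \<Rightarrow> real" where
  "P_NR K n pd xi s s' =
     (\<Sum>(k, k')\<in>Kpairs K. pc K n (fst s) k k' * P_tilde K n pd xi k k' s s')"

definition pi_ext :: "nat \<Rightarrow> (config \<Rightarrow> real) \<Rightarrow> config \<times> velocity \<Rightarrow> real" where
  "pi_ext K pd s = pd (fst s) / 2 ^ card (Kpairs K)"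

end

theory Submission
  imports Defs
begin

text \<open>In a finite state space every \<open>f\<close> of mean zero splits as \<open>f = (I - P) u + r\<close> with \<open>r\<close>
  orthogonal to the range of \<open>I - P\<close> in \<open>L\<^sup>2\<close>. The asymptotic variance is infinite if \<open>r\<close> is not
  null, and equals \<open>2 \<langle>f, u\<rangle> - \<langle>f, f\<rangle>\<close> otherwise, where \<open>\<langle>f, u\<rangle> = \<langle>u, (I - P) u\<rangle>\<close>. Asymptotic variances
  can therefore be compared through the energies \<open>\<langle>u, (I - P) u\<rangle>\<close>, even when only one of the two
  kernels is reversible.

  For the second inequality, \<open>P_MG \<le> 2 (K - 1) P_R\<close> off the diagonal gives the energy comparison
  (Peskun). For the first one, \<open>P_NR\<close> satisfies detailed balance up to negation of all velocities,
  and this makes the cross terms cancel between the velocity average of \<open>u\<close> and the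
  remainder: the energy of \<open>u\<close> under \<open>P_NR\<close> is the energy of its velocity average under \<open>P_R\<close> plus a
  nonnegative term.\<close>

section \<open>Weighted inner products and stationary chains\<close>

text \<open>\<open>pd\<close> may vanish and the chains may be reducible or periodic. So
  \<open>I - P\<close> need not be injective on mean-zero functions, powers of \<open>P\<close> need
  not converge, and \<open>ip\<close> is only semidefinite. This excludes inverses and convergence
  of the covariance series: \<open>u\<close> and the remainder come from an orthogonal projection
  onto the range of \<open>I - P\<close>, vanishing is weakened to having norm 0, and for each
  finite \<open>T\<close> the scaled variance is computed exactly, the covariances telescoping along
  the decomposition. The limit, finite or not, is read off that formula.

  The comparison is proved once for a map \<open>pr\<close> between state spaces and its
  \<open>L\<^sup>2\<close> adjoint \<open>bar\<close>. Peskun's case takes both to be identities;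
  the lifted chain takes \<open>fst\<close> and the average over velocities, with constant 1.

  Division by zero matters off the support: acceptance probabilities lie in [0,1] whatever the
  quotient is, so \<open>P_R\<close> and \<open>P_NR\<close> keep stochastic rows, whereas rows of
  \<open>P_MG\<close> can lose mass.\<close>

definition ip :: "'s set \<Rightarrow> ('s \<Rightarrow> real) \<Rightarrow> ('s \<Rightarrow> real) \<Rightarrow> ('s \<Rightarrow> real) \<Rightarrow> real" where
  "ip S mu f g = (\<Sum>x\<in>S. mu x * (f x * g x))"

definition kstep :: "'s set \<Rightarrow> ('s \<Rightarrow> 's \<Rightarrow> real) \<Rightarrow> ('s \<Rightarrow> real) \<Rightarrow> 's \<Rightarrow> real" where
  "kstep S P f x = (\<Sum>y\<in>S. P x y * f y)"

lemma ip_commute: "ip S mu f g = ip S mu g f"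
  by (simp add: ip_def mult.commute)

lemma ip_linear:
  "ip S mu (\<lambda>x. f x + g x) k = ip S mu f k + ip S mu g k"
  "ip S mu k (\<lambda>x. f x + g x) = ip S mu k f + ip S mu k g"
  "ip S mu (\<lambda>x. f x - g x) k = ip S mu f k - ip S mu g k"
  "ip S mu k (\<lambda>x. f x - g x) = ip S mu k f - ip S mu k g"
  "ip S mu (\<lambda>x. a * f x) k = a * ip S mu f k"
  "ip S mu k (\<lambda>x. a * f x) = a * ip S mu k f"
  by (simp_all add: ip_def algebra_simps sum.distrib sum_subtractf sum_distrib_left)

lemma ip_cong:
  "(\<And>x. x \<in> S \<Longrightarrow> f x = f' x) \<Longrightarrow> (\<And>x. x \<in> S \<Longrightarrow> g x = g' x) \<Longrightarrow> ip S mu f g = ip S mu f' g'"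
  by (simp add: ip_def)

lemma ip_sum_right: "ip S mu k (\<lambda>x. \<Sum>t\<in>I. F t x) = (\<Sum>t\<in>I. ip S mu k (F t))"
  unfolding ip_def by (simp add: sum_distrib_left) (rule sum.swap)

lemma kstep_linear:
  "kstep S P (\<lambda>x. f x + g x) = (\<lambda>x. kstep S P f x + kstep S P g x)"
  "kstep S P (\<lambda>x. f x - g x) = (\<lambda>x. kstep S P f x - kstep S P g x)"
  "kstep S P (\<lambda>x. a * f x) = (\<lambda>x. a * kstep S P f x)"
  by (simp_all add: kstep_def fun_eq_iff algebra_simps sum.distrib sum_subtractf sum_distrib_left)

lemma kstep_sum: "kstep S P (\<lambda>x. \<Sum>t\<in>I. F t x) = (\<lambda>x. \<Sum>t\<in>I. kstep S P (F t) x)"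
  unfolding kstep_def fun_eq_iff by (simp add: sum_distrib_left) (intro allI sum.swap)

lemma kstep_cong: "(\<And>y. y \<in> S \<Longrightarrow> f y = g y) \<Longrightarrow> kstep S P f = kstep S P g"
  by (simp add: kstep_def fun_eq_iff)

lemma ip_nonneg: "(\<And>x. x \<in> S \<Longrightarrow> mu x \<ge> 0) \<Longrightarrow> ip S mu f f \<ge> 0"
  by (auto simp: ip_def intro!: sum_nonneg)

lemma form_null:
  fixes a b d :: real
  assumes "\<And>t. a + 2 * t * b + t\<^sup>2 * d \<ge> 0" and "a = 0"
  shows "b = 0"
proof (rule ccontr)
  assume "b \<noteq> 0"
  \<comment> \<open>\<open>D\<close> is positive and dominates \<open>d\<close>, so at
    \<open>t = - b / D\<close> the polynomial is at most \<open>- b\<^sup>2 / D\<close>.\<close>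
  define D where "D = \<bar>d\<bar> + 1"
  define t where "t = - b / D"
  have p: "D > 0" "d \<le> D" by (auto simp: D_def)
  have "2 * t * b + t\<^sup>2 * d \<le> 2 * t * b + t\<^sup>2 * D"
    using p by (intro add_left_mono mult_left_mono) auto
  also have "\<dots> = - b\<^sup>2 / D"
    using p by (simp add: t_def power2_eq_square field_simps)
  also have "\<dots> < 0" using \<open>b \<noteq> 0\<close> p by (simp add: field_simps)
  finally show False using assms(1)[of t] assms(2) by simp
qed

text \<open>The degenerate case of Cauchy-Schwarz: the square norm of \<open>z + t f\<close> is a
  nonnegative polynomial in \<open>t\<close> without constant term, hence without linear
  term.\<close>

lemma ip_null:
  assumes "\<And>x. x \<in> S \<Longrightarrow> mu x \<ge> 0" and "ip S mu z z = 0"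
  shows "ip S mu f z = 0" and "ip S mu z f = 0"
proof -
  have "ip S mu z z + 2 * t * ip S mu f z + t\<^sup>2 * ip S mu f f \<ge> 0" for t
  proof -
    have "0 \<le> ip S mu (\<lambda>x. z x + t * f x) (\<lambda>x. z x + t * f x)"
      by (rule ip_nonneg) (rule assms)
    then show ?thesis
      by (simp add: ip_linear algebra_simps power2_eq_square ip_commute[of S mu z f])
  qed
  from form_null[OF this assms(2)] show "ip S mu f z = 0" .
  then show "ip S mu z f = 0" by (simp add: ip_commute)
qed

text \<open>Gram-Schmidt by induction on \<open>I\<close>: the induction hypothesis is applied both
  to \<open>f\<close> and to the new vector \<open>b i\<close>, and the residual of \<open>f\<close>
  is then corrected along that of \<open>b i\<close>.\<close>

lemma ip_projection:
  assumes "\<And>x. x \<in> S \<Longrightarrow> mu x \<ge> 0" and "finite I"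
  shows "\<exists>h. \<forall>t\<in>I. ip S mu (\<lambda>x. f x - (\<Sum>s\<in>I. h s * b s x)) (b t) = 0"
  using assms(2)
proof (induction I arbitrary: f)
  case empty
  then show ?case by simp
next
  case (insert i I)
  obtain h where h: "\<And>t. t \<in> I \<Longrightarrow> ip S mu (\<lambda>x. f x - (\<Sum>s\<in>I. h s * b s x)) (b t) = 0"
    using insert.IH[of f] by blast
  obtain k where k: "\<And>t. t \<in> I \<Longrightarrow> ip S mu (\<lambda>x. b i x - (\<Sum>s\<in>I. k s * b s x)) (b t) = 0"
    using insert.IH[of "b i"] by blast
  define f' where "f' = (\<lambda>x. f x - (\<Sum>s\<in>I. h s * b s x))"
  define b' where "b' = (\<lambda>x. b i x - (\<Sum>s\<in>I. k s * b s x))"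
  \<comment> \<open>If \<open>b'\<close> is null, the quotient is 0 by convention, which is a
    correct coefficient because \<open>f'\<close> is then orthogonal to \<open>b'\<close>
    anyway.\<close>
  define a where "a = ip S mu f' b' / ip S mu b' b'"
  have a: "ip S mu f' b' = a * ip S mu b' b'"
    using ip_null(1)[OF assms(1), where z = b' and f = f'] by (cases "ip S mu b' b' = 0") (auto simp: a_def)
  define l where "l = (\<lambda>s. if s = i then a else h s - a * k s)"
  have l: "(\<lambda>x. f x - (\<Sum>s\<in>insert i I. l s * b s x)) = (\<lambda>x. f' x - a * b' x)"
  proof
    fix x
    have "(\<Sum>s\<in>I. l s * b s x) = (\<Sum>s\<in>I. (h s - a * k s) * b s x)"
      using insert.hyps by (intro sum.cong) (auto simp: l_def)
    then show "f x - (\<Sum>s\<in>insert i I. l s * b s x) = f' x - a * b' x"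
      using insert.hyps
      by (simp add: f'_def b'_def l_def algebra_simps sum_subtractf sum_distrib_left)
  qed
  have I: "ip S mu (\<lambda>x. f' x - a * b' x) (b t) = 0" if "t \<in> I" for t
    using h[OF that] k[OF that] by (simp add: f'_def[symmetric] b'_def[symmetric] ip_linear)
  have "b i = (\<lambda>x. b' x + (\<Sum>s\<in>I. k s * b s x))" by (simp add: b'_def)
  then have "ip S mu (\<lambda>x. f' x - a * b' x) (b i) =
      ip S mu (\<lambda>x. f' x - a * b' x) b' + (\<Sum>s\<in>I. k s * ip S mu (\<lambda>x. f' x - a * b' x) (b s))"
    by (simp only: ip_linear(2,6) ip_sum_right)
  also have "\<dots> = 0" using a I by (simp add: ip_linear(3,5))
  finally show ?case using I l by (intro exI[of _ l]) auto
qed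

section \<open>Finite stationary chains: contraction and decomposition along the range of
  \<open>I - P\<close>\<close>

locale stationary_chain =
  fixes S :: "'s set" and mu :: "'s \<Rightarrow> real" and P :: "'s \<Rightarrow> 's \<Rightarrow> real"
  assumes finite_S: "finite S"
    and mu_nonneg: "x \<in> S \<Longrightarrow> mu x \<ge> 0"
    and P_nonneg: "x \<in> S \<Longrightarrow> y \<in> S \<Longrightarrow> P x y \<ge> 0"
    and row_sum: "x \<in> S \<Longrightarrow> (\<Sum>y\<in>S. P x y) = 1"
    and invariant: "y \<in> S \<Longrightarrow> (\<Sum>x\<in>S. mu x * P x y) = mu y"
    and total: "(\<Sum>x\<in>S. mu x) = 1"
begin

abbreviation inner (infix "\<bullet>" 70) where "f \<bullet> g \<equiv> ip S mu f g"
abbreviation step where "step \<equiv> kstep S P"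

lemma sum_mu_step: "(\<Sum>x\<in>S. mu x * step f x) = (\<Sum>x\<in>S. mu x * f x)"
proof -
  have "(\<Sum>x\<in>S. mu x * step f x) = (\<Sum>y\<in>S. \<Sum>x\<in>S. mu x * P x y * f y)"
    by (subst sum.swap) (simp add: kstep_def sum_distrib_left mult.assoc)
  also have "\<dots> = (\<Sum>y\<in>S. mu y * f y)"
    by (intro sum.cong) (simp_all add: sum_distrib_right[symmetric] invariant)
  finally show ?thesis .
qed

text \<open>Expand the square: row sums turn one square term into \<open>f \<bullet> f\<close>,
  invariance does the same for the other. The identity is thus available for kernels that are not
  reversible, such as \<open>P_NR\<close>.\<close>

lemma dirichlet:
  "f \<bullet> f - f \<bullet> step f = (\<Sum>x\<in>S. \<Sum>y\<in>S. mu x * P x y * (f x - f y)\<^sup>2) / 2"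
proof -
  have 1: "(\<Sum>x\<in>S. \<Sum>y\<in>S. mu x * P x y * (f x)\<^sup>2) = f \<bullet> f"
    by (simp add: ip_def mult.assoc[symmetric] sum_distrib_right[symmetric] sum_distrib_left[symmetric]
        row_sum power2_eq_square)
  have 2: "(\<Sum>x\<in>S. \<Sum>y\<in>S. mu x * P x y * (f y)\<^sup>2) = f \<bullet> f"
    using sum_mu_step[of "\<lambda>x. (f x)\<^sup>2"]
    by (simp add: ip_def kstep_def sum_distrib_left mult.assoc power2_eq_square)
  have 3: "(\<Sum>x\<in>S. \<Sum>y\<in>S. mu x * P x y * (f x * f y)) = f \<bullet> step f"
    by (simp add: ip_def kstep_def sum_distrib_left algebra_simps)
  have "(\<Sum>x\<in>S. \<Sum>y\<in>S. mu x * P x y * (f x - f y)\<^sup>2) =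
    (\<Sum>x\<in>S. \<Sum>y\<in>S. mu x * P x y * (f x)\<^sup>2) + (\<Sum>x\<in>S. \<Sum>y\<in>S. mu x * P x y * (f y)\<^sup>2)
     - 2 * (\<Sum>x\<in>S. \<Sum>y\<in>S. mu x * P x y * (f x * f y))"
    by (simp add: sum_distrib_left sum.distrib sum_subtractf power2_eq_square algebra_simps)
  then show ?thesis using 1 2 3 by simp
qed

lemma dirichlet_nonneg: "f \<bullet> step f \<le> f \<bullet> f"
proof -
  have "(\<Sum>x\<in>S. \<Sum>y\<in>S. mu x * P x y * (f x - f y)\<^sup>2) \<ge> 0"
    by (intro sum_nonneg mult_nonneg_nonneg mu_nonneg P_nonneg) auto
  then show ?thesis using dirichlet[of f] by simp
qed

text \<open>Jensen's inequality at each state, in the form that the variance of \<open>f\<close>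
  under \<open>P x\<close> is nonnegative, followed by invariance.\<close>

lemma step_contraction: "step f \<bullet> step f \<le> f \<bullet> f"
proof -
  have "(step f x)\<^sup>2 \<le> step (\<lambda>y. (f y)\<^sup>2) x" if "x \<in> S" for x
  proof -
    define m where "m = step f x"
    have "0 \<le> (\<Sum>y\<in>S. P x y * (f y - m)\<^sup>2)"
      using that by (intro sum_nonneg mult_nonneg_nonneg P_nonneg) auto
    also have "\<dots> = (\<Sum>y\<in>S. P x y * (f y)\<^sup>2) - 2 * m * (\<Sum>y\<in>S. P x y * f y) + m\<^sup>2 * (\<Sum>y\<in>S. P x y)"
      by (simp add: sum_distrib_left sum.distrib sum_subtractf power2_eq_square algebra_simps)
    also have "\<dots> = step (\<lambda>y. (f y)\<^sup>2) x - m\<^sup>2"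
      using row_sum[OF that] by (simp add: m_def kstep_def power2_eq_square)
    finally show ?thesis by (simp add: m_def)
  qed
  then have "step f \<bullet> step f \<le> (\<Sum>x\<in>S. mu x * step (\<lambda>y. (f y)\<^sup>2) x)"
    unfolding ip_def by (intro sum_mono mult_left_mono) (auto simp: mu_nonneg power2_eq_square)
  also have "\<dots> = f \<bullet> f" by (simp add: sum_mu_step ip_def power2_eq_square)
  finally show ?thesis .
qed

lemma steps_contraction: "(step ^^ t) f \<bullet> (step ^^ t) f \<le> f \<bullet> f"
  by (induction t) (auto intro: order_trans[OF step_contraction])

lemma inner_bound: "\<bar>f \<bullet> (step ^^ t) h\<bar> \<le> f \<bullet> f + h \<bullet> h"
proof -
  let ?k = "(step ^^ t) h"
  have "0 \<le> (\<lambda>x. f x + ?k x) \<bullet> (\<lambda>x. f x + ?k x)" "0 \<le> (\<lambda>x. f x - ?k x) \<bullet> (\<lambda>x. f x - ?k x)"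
    "0 \<le> f \<bullet> f" "0 \<le> h \<bullet> h"
    by (auto intro!: ip_nonneg mu_nonneg)
  then show ?thesis
    using steps_contraction[of t h] by (simp add: ip_linear ip_commute[of S mu ?k f])
qed

lemma steps_diff: "(step ^^ t) (\<lambda>x. f x - g x) = (\<lambda>x. (step ^^ t) f x - (step ^^ t) g x)"
  by (induction t) (simp_all add: kstep_linear)

lemma steps_add: "(step ^^ t) (\<lambda>x. f x + g x) = (\<lambda>x. (step ^^ t) f x + (step ^^ t) g x)"
  by (induction t) (simp_all add: kstep_linear)

definition orth :: "('s \<Rightarrow> real) \<Rightarrow> bool" where
  "orth r \<longleftrightarrow> (\<forall>f. r \<bullet> step f = r \<bullet> f)"

lemma decomposition: "\<exists>h r. f = (\<lambda>x. h x - step h x + r x) \<and> orth r"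
proof -
  \<comment> \<open>The images \<open>?b s\<close> of the point indicators under
    \<open>I - step\<close> span its range, so projecting onto them produces the
    decomposition.\<close>
  let ?d = "\<lambda>s x. if x = s then 1 else (0::real)"
  let ?b = "\<lambda>s x. ?d s x - step (?d s) x"
  obtain h where h: "\<And>t. t \<in> S \<Longrightarrow> (\<lambda>x. f x - (\<Sum>s\<in>S. h s * ?b s x)) \<bullet> ?b t = 0"
    using ip_projection[of S mu S f ?b, OF mu_nonneg finite_S] by auto
  define h' where "h' = (\<lambda>x. \<Sum>s\<in>S. h s * ?d s x)"
  define r where "r = (\<lambda>x. f x - (\<Sum>s\<in>S. h s * ?b s x))"
  have expand: "(\<lambda>x. \<Sum>s\<in>S. k s * ?b s x) =
      (\<lambda>x. (\<Sum>s\<in>S. k s * ?d s x) - step (\<lambda>x. \<Sum>s\<in>S. k s * ?d s x) x)" for k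
    unfolding kstep_sum by (simp only: kstep_linear right_diff_distrib sum_subtractf)
  have "f = (\<lambda>x. h' x - step h' x + r x)"
    unfolding h'_def using expand[of h] by (simp add: r_def fun_eq_iff)
  moreover have "orth r"
    unfolding orth_def
  proof
    fix k
    \<comment> \<open>Inner products and \<open>step\<close> see only values on \<open>S\<close>,
      where \<open>k\<close> equals its expansion in point indicators.\<close>
    have k: "(\<Sum>s\<in>S. k s * ?d s x) = k x" if "x \<in> S" for x
      using that finite_S by (simp add: if_distrib[of "(*) _"] cong: if_cong)
    have "r \<bullet> k - r \<bullet> step k = r \<bullet> (\<lambda>x. k x - step k x)"
      by (simp add: ip_linear)
    also have "\<dots> = r \<bullet> (\<lambda>x. \<Sum>s\<in>S. k s * ?b s x)"
      unfolding expand by (intro ip_cong) (auto simp: k cong: kstep_cong)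
    also have "\<dots> = (\<Sum>s\<in>S. k s * (r \<bullet> ?b s))"
      by (simp only: ip_sum_right ip_linear(6))
    also have "\<dots> = 0" using h by (simp add: r_def)
    finally show "r \<bullet> step k = r \<bullet> k" by simp
  qed
  ultimately show ?thesis by blast
qed

lemma orth_steps: "orth r \<Longrightarrow> r \<bullet> (step ^^ t) f = r \<bullet> f"
  by (induction t) (auto simp: orth_def)

text \<open>\<open>orth r\<close> says that the adjoint of \<open>step\<close> fixes
  \<open>r\<close>. For a contraction the operator itself then fixes \<open>r\<close> up to a null
  function: in the square norm of \<open>step^t r - r\<close> the cross term equals the square norm
  of \<open>r\<close>, leaving a difference that is at most 0.\<close>

lemma orth_fixed:
  assumes "orth r"
  shows "f \<bullet> (step ^^ t) r = f \<bullet> r"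
proof -
  have "(\<lambda>x. (step ^^ t) r x - r x) \<bullet> (\<lambda>x. (step ^^ t) r x - r x) =
      (step ^^ t) r \<bullet> (step ^^ t) r - r \<bullet> r"
    using orth_steps[OF assms, of t r] by (simp add: ip_linear ip_commute[of S mu "(step ^^ t) r" r])
  also have "\<dots> \<le> 0" using steps_contraction by simp
  finally have "(\<lambda>x. (step ^^ t) r x - r x) \<bullet> (\<lambda>x. (step ^^ t) r x - r x) = 0"
    using ip_nonneg[of S mu, OF mu_nonneg] by (metis order_antisym)
  from ip_null(1)[OF mu_nonneg this, of f] show ?thesis by (simp add: ip_linear)
qed

end

section \<open>Variance of ergodic averages\<close>

lemma sum_paths_0: "(\<Sum>xs\<in>paths S 0. F xs) = (\<Sum>x\<in>S. F [x])"
proof -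
  have "paths S 0 = (\<lambda>x. [x]) ` S"
    by (auto simp: paths_def length_Suc_conv)
  then show ?thesis by (simp add: sum.reindex inj_on_def)
qed

lemma sum_paths_Suc: "(\<Sum>xs\<in>paths S (Suc T). F xs) = (\<Sum>x\<in>S. \<Sum>ys\<in>paths S T. F (x # ys))"
proof -
  have "paths S (Suc T) = (\<lambda>(x, ys). x # ys) ` (S \<times> paths S T)"
    by (auto simp: paths_def length_Suc_conv[of _ "Suc T"] image_iff)
  then show ?thesis
    by (simp add: sum.reindex inj_on_def sum.cartesian_product split_def)
qed

lemma path_prob_Cons:
  "ys \<in> paths S T \<Longrightarrow> path_prob mu P (x # ys) = mu x * path_prob (P x) P ys"
  by (cases ys) (auto simp: path_prob_def paths_def prod.lessThan_Suc_shift simp del: prod.lessThan_Suc)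

lemma path_prob_linear: "path_prob (\<lambda>y. \<Sum>x\<in>S. mu x * P x y) Q ys = (\<Sum>x\<in>S. mu x * path_prob (P x) Q ys)"
  by (simp add: path_prob_def sum_distrib_left sum_distrib_right algebra_simps)

text \<open>A path that starts in the support of \<open>mu\<close> can leave it only by a step of
  probability 0, so rows outside the support never count. The initial weights \<open>q\<close> are
  general because removing the first state \<open>x\<close> replaces them by
  \<open>P x\<close>.\<close>

lemma path_prob_cong:
  assumes "\<And>x y. x \<in> S \<Longrightarrow> y \<in> S \<Longrightarrow> mu x \<noteq> 0 \<Longrightarrow> P x y = P' x y"
    and "\<And>x y. x \<in> S \<Longrightarrow> y \<in> S \<Longrightarrow> mu x \<noteq> 0 \<Longrightarrow> mu y = 0 \<Longrightarrow> P x y = 0"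
  shows "xs \<in> paths S T \<Longrightarrow> mu (xs ! 0) \<noteq> 0 \<Longrightarrow> path_prob q P xs = path_prob q P' xs"
proof (induction T arbitrary: xs q)
  case 0
  then show ?case by (auto simp: paths_def path_prob_def)
next
  case (Suc T)
  then obtain x ys where xs: "xs = x # ys" "x \<in> S" "ys \<in> paths S T"
    by (auto simp: paths_def length_Suc_conv[of _ "Suc T"])
  then have y: "ys ! 0 \<in> S" by (cases ys) (auto simp: paths_def)
  have "path_prob (P x) P ys = path_prob (P' x) P' ys"
  proof (cases "mu (ys ! 0) = 0")
    case True
    then show ?thesis using assms xs y Suc.prems by (simp add: path_prob_def)
  next
    case False
    then have "path_prob (P x) P ys = path_prob (P x) P' ys"
      using Suc.IH xs by blast
    then show ?thesis using assms(1) xs y Suc.prems by (simp add: path_prob_def)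
  qed
  then show ?case using xs by (simp add: path_prob_Cons)
qed

text \<open>This permits redefining a kernel off the support of \<open>mu\<close>, as is done for
  the marginal Gibbs kernel.\<close>

lemma asym_var_cong:
  assumes "\<And>x y. x \<in> S \<Longrightarrow> y \<in> S \<Longrightarrow> mu x \<noteq> 0 \<Longrightarrow> P x y = P' x y"
    and "\<And>x y. x \<in> S \<Longrightarrow> y \<in> S \<Longrightarrow> mu x \<noteq> 0 \<Longrightarrow> mu y = 0 \<Longrightarrow> P x y = 0"
  shows "asym_var S mu P g = asym_var S mu P' g"
proof -
  have "path_prob mu P xs = path_prob mu P' xs" if "xs \<in> paths S T" for xs T
  proof (cases "mu (xs ! 0) = 0")
    case True
    then show ?thesis by (simp add: path_prob_def)
  next
    case False
    then show ?thesis using path_prob_cong[of S mu P P'] assms that by blast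
  qed
  then have "var_avg S mu P g T = var_avg S mu P' g T" for T
    by (simp add: var_avg_def)
  then show ?thesis by (simp add: asym_var_def)
qed

definition path_sum :: "('s \<Rightarrow> real) \<Rightarrow> nat \<Rightarrow> 's list \<Rightarrow> real" where
  "path_sum g T xs = (\<Sum>t\<le>T. g (xs ! t))"

lemma path_sum_Cons: "path_sum g (Suc T) (x # ys) = g x + path_sum g T ys"
  by (simp add: path_sum_def sum.atMost_Suc_shift del: sum.atMost_Suc)

text \<open>The average runs over times 1 to \<open>Suc T\<close>, so the state at time 0 is absent
  and the tail carries all \<open>Suc T\<close> summands.\<close>

lemma erg_avg_Cons: "erg_avg g (Suc T) (x # ys) = path_sum g T ys / real (Suc T)"
proof -
  have "(\<Sum>t\<in>{1..Suc T}. g ((x # ys) ! t)) = path_sum g T ys"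
    unfolding path_sum_def using sum.shift_bounds_cl_Suc_ivl[of "\<lambda>t. g ((x # ys) ! t)" 0 T]
    by (simp add: atMost_atLeast0)
  then show ?thesis by (simp add: erg_avg_def)
qed

context stationary_chain
begin

definition path_exp :: "('s \<Rightarrow> real) \<Rightarrow> nat \<Rightarrow> ('s list \<Rightarrow> real) \<Rightarrow> real" where
  "path_exp q T F = (\<Sum>xs\<in>paths S T. path_prob q P xs * F xs)"

lemma path_exp_0: "path_exp q 0 F = (\<Sum>x\<in>S. q x * F [x])"
  by (simp add: path_exp_def sum_paths_0 path_prob_def)

lemma path_exp_Suc: "path_exp q (Suc T) F = (\<Sum>x\<in>S. q x * path_exp (P x) T (\<lambda>ys. F (x # ys)))"
  by (simp add: path_exp_def sum_paths_Suc path_prob_Cons sum_distrib_left mult.assoc)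

lemma path_exp_linear:
  "path_exp q T (\<lambda>xs. F xs + G xs) = path_exp q T F + path_exp q T G"
  "path_exp q T (\<lambda>xs. a * F xs) = a * path_exp q T F"
  by (simp_all add: path_exp_def algebra_simps sum.distrib sum_distrib_left)

text \<open>Dropping the first state of a stationary path leaves a stationary path; this discards
  the time 0 that the averages skip.\<close>

lemma path_exp_invariant: "(\<Sum>x\<in>S. mu x * path_exp (P x) T F) = path_exp mu T F"
proof -
  have "(\<Sum>x\<in>S. mu x * path_exp (P x) T F) = path_exp (\<lambda>y. \<Sum>x\<in>S. mu x * P x y) T F"
    unfolding path_exp_def path_prob_linear
    by (simp add: sum_distrib_left sum_distrib_right mult.assoc) (rule sum.swap)
  also have "\<dots> = path_exp mu T F"
  proof -
    have "path_prob (\<lambda>y. \<Sum>x\<in>S. mu x * P x y) P xs = path_prob mu P xs" if "xs \<in> paths S T" for xs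
    proof -
      have "xs ! 0 \<in> S" using that by (cases xs) (auto simp: paths_def)
      then show ?thesis by (simp add: path_prob_def invariant)
    qed
    then show ?thesis by (simp add: path_exp_def)
  qed
  finally show ?thesis .
qed

lemma path_exp_const: "path_exp q T (\<lambda>_. a) = (\<Sum>x\<in>S. q x) * a"
proof (induction T arbitrary: q)
  case 0
  then show ?case by (simp add: path_exp_0 sum_distrib_right)
next
  case (Suc T)
  then show ?case by (simp add: path_exp_Suc row_sum sum_distrib_right[symmetric])
qed

lemma path_exp_path_sum:
  "path_exp q T (path_sum g T) = (\<Sum>x\<in>S. q x * (\<Sum>t\<le>T. (step ^^ t) g x))"
proof (induction T arbitrary: q)
  case 0
  then show ?case by (simp add: path_exp_0 path_sum_def)
next
  case (Suc T)
  have "path_exp (P x) T (\<lambda>ys. path_sum g (Suc T) (x # ys)) = (\<Sum>t\<le>Suc T. (step ^^ t) g x)"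
    if "x \<in> S" for x
  proof -
    have "path_exp (P x) T (\<lambda>ys. path_sum g (Suc T) (x # ys)) =
        g x + step (\<lambda>y. \<Sum>t\<le>T. (step ^^ t) g y) x"
      unfolding kstep_def[of S P _ x] using that
      by (simp add: path_sum_Cons path_exp_linear path_exp_const row_sum Suc.IH)
    also have "\<dots> = (\<Sum>t\<le>Suc T. (step ^^ t) g x)"
      by (simp add: kstep_sum sum.atMost_Suc_shift del: sum.atMost_Suc)
    finally show ?thesis .
  qed
  then show ?case by (simp add: path_exp_Suc)
qed

definition mean :: "('s \<Rightarrow> real) \<Rightarrow> real" where
  "mean g = (\<Sum>x\<in>S. mu x * g x)"

lemma mean_steps: "mean ((step ^^ t) g) = mean g"
  by (induction t) (simp_all add: mean_def sum_mu_step)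

lemma path_exp_mu_path_sum: "path_exp mu T (path_sum g T) = real (Suc T) * mean g"
proof -
  have "path_exp mu T (path_sum g T) = (\<Sum>t\<le>T. mean ((step ^^ t) g))"
    unfolding path_exp_path_sum mean_def by (simp add: sum_distrib_left) (rule sum.swap)
  then show ?thesis by (simp add: mean_steps)
qed

lemma path_exp_mu_square_0: "path_exp mu 0 (\<lambda>xs. (path_sum g 0 xs)\<^sup>2) = g \<bullet> g"
  by (simp add: path_exp_0 path_sum_def ip_def power2_eq_square)

text \<open>Split off the first state. Given that state, the rest of the sum has expectation a sum
  of powers of \<open>step\<close>, which gives the covariances; by stationarity its square
  contributes the same quantity at length \<open>T\<close>.\<close>

lemma path_exp_mu_square_Suc:
  "path_exp mu (Suc T) (\<lambda>xs. (path_sum g (Suc T) xs)\<^sup>2) =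
     g \<bullet> g + 2 * (\<Sum>t\<le>T. g \<bullet> (step ^^ Suc t) g) + path_exp mu T (\<lambda>xs. (path_sum g T xs)\<^sup>2)"
proof -
  have "path_exp (P x) T (\<lambda>ys. (path_sum g (Suc T) (x # ys))\<^sup>2) =
      g x * g x + 2 * (g x * (\<Sum>t\<le>T. (step ^^ Suc t) g x)) + path_exp (P x) T (\<lambda>ys. (path_sum g T ys)\<^sup>2)"
    if "x \<in> S" for x
  proof -
    have "(path_sum g (Suc T) (x # ys))\<^sup>2 = g x * g x + (2 * g x * path_sum g T ys + (path_sum g T ys)\<^sup>2)" for ys
      by (simp add: path_sum_Cons power2_eq_square algebra_simps)
    moreover have "path_exp (P x) T (path_sum g T) = (\<Sum>t\<le>T. (step ^^ Suc t) g x)"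
      unfolding path_exp_path_sum kstep_def[of S P, symmetric] kstep_sum by simp
    ultimately show ?thesis
      using that by (simp only: path_exp_linear path_exp_const row_sum mult_1 mult.assoc)
  qed
  then have "path_exp mu (Suc T) (\<lambda>xs. (path_sum g (Suc T) xs)\<^sup>2) =
     g \<bullet> g + 2 * (\<Sum>x\<in>S. mu x * (g x * (\<Sum>t\<le>T. (step ^^ Suc t) g x)))
      + path_exp mu T (\<lambda>xs. (path_sum g T xs)\<^sup>2)"
    using path_exp_invariant[of T "\<lambda>xs. (path_sum g T xs)\<^sup>2"]
    by (simp add: path_exp_Suc ip_def distrib_left sum.distrib sum_distrib_left algebra_simps)
  also have "(\<Sum>x\<in>S. mu x * (g x * (\<Sum>t\<le>T. (step ^^ Suc t) g x))) = (\<Sum>t\<le>T. g \<bullet> (step ^^ Suc t) g)"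
    by (simp only: ip_sum_right[symmetric]) (simp only: ip_def)
  finally show ?thesis .
qed

lemma var_avg_Suc:
  "var_avg S mu P g (Suc T) =
    (path_exp mu T (\<lambda>xs. (path_sum g T xs)\<^sup>2) - (real (Suc T) * mean g)\<^sup>2) / (real (Suc T))\<^sup>2"
proof -
  have shift: "(\<Sum>xs\<in>paths S (Suc T). path_prob mu P xs * F (erg_avg g (Suc T) xs)) =
      path_exp mu T (\<lambda>ys. F (path_sum g T ys / real (Suc T)))" for F :: "real \<Rightarrow> real"
    unfolding path_exp_def[of mu "Suc T", symmetric] path_exp_Suc erg_avg_Cons path_exp_invariant ..
  have "path_exp mu T (\<lambda>ys. path_sum g T ys / real (Suc T)) = real (Suc T) * mean g / real (Suc T)"
    using path_exp_linear(2)[of mu T "1 / real (Suc T)" "path_sum g T"]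
    by (simp add: path_exp_mu_path_sum del: of_nat_Suc)
  moreover have "path_exp mu T (\<lambda>ys. (path_sum g T ys / real (Suc T))\<^sup>2) =
      path_exp mu T (\<lambda>ys. (path_sum g T ys)\<^sup>2) / (real (Suc T))\<^sup>2"
    using path_exp_linear(2)[of mu T "1 / (real (Suc T))\<^sup>2" "\<lambda>ys. (path_sum g T ys)\<^sup>2"]
    by (simp add: power_divide del: of_nat_Suc)
  ultimately show ?thesis
    unfolding var_avg_def using shift[of "\<lambda>z. z\<^sup>2"] shift[of "\<lambda>z. z"]
    by (simp add: diff_divide_distrib power_mult_distrib del: of_nat_Suc)
qed

end

section \<open>Asymptotic variance and its comparison\<close>

context stationary_chain
begin

definition centered :: "('s \<Rightarrow> real) \<Rightarrow> 's \<Rightarrow> real" where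
  "centered g = (\<lambda>x. g x - mean g)"

lemma mean_centered: "mean (centered g) = 0"
  using total by (simp add: mean_def centered_def right_diff_distrib sum_subtractf sum_distrib_right[symmetric])

lemma steps_const: "x \<in> S \<Longrightarrow> (step ^^ t) (\<lambda>_. a) x = a"
proof (induction t arbitrary: x)
  case (Suc t)
  have "step ((step ^^ t) (\<lambda>_. a)) = step (\<lambda>_. a)"
    by (rule kstep_cong) (rule Suc.IH)
  then have "(step ^^ Suc t) (\<lambda>_. a) x = step (\<lambda>_. a) x" by simp
  also have "\<dots> = a"
    using Suc.prems by (simp add: kstep_def sum_distrib_right[symmetric] row_sum)
  finally show ?case .
qed simp

lemma inner_steps_centered:
  "g \<bullet> (step ^^ t) g = centered g \<bullet> (step ^^ t) (centered g) + (mean g)\<^sup>2"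
proof -
  let ?f = "centered g" and ?m = "mean g"
  have shift: "(\<lambda>x. F x + m) \<bullet> (\<lambda>x. G x + m) =
      F \<bullet> G + m * mean F + m * mean G + m * m * (\<Sum>x\<in>S. mu x)" for m F G
    by (simp add: ip_def mean_def algebra_simps sum.distrib sum_distrib_left)
  have "(step ^^ t) g = (\<lambda>x. (step ^^ t) ?f x + (step ^^ t) (\<lambda>_. ?m) x)"
    by (subst steps_add[symmetric]) (simp add: centered_def)
  then have "g \<bullet> (step ^^ t) g = (\<lambda>x. ?f x + ?m) \<bullet> (\<lambda>x. (step ^^ t) ?f x + ?m)"
    by (intro ip_cong) (simp_all add: centered_def steps_const)
  also have "\<dots> = ?f \<bullet> (step ^^ t) ?f + ?m * mean ?f + ?m * mean ((step ^^ t) ?f) + ?m * ?m * (\<Sum>x\<in>S. mu x)"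
    by (rule shift)
  also have "\<dots> = ?f \<bullet> (step ^^ t) ?f + ?m\<^sup>2"
    by (simp add: mean_steps mean_centered total power2_eq_square)
  finally show ?thesis .
qed

lemma var_dist_centered: "var_dist S mu g = centered g \<bullet> centered g"
  using inner_steps_centered[of g 0]
  by (simp add: var_dist_def ip_def mean_def power2_eq_square)

lemma decomp_inner_remainder:
  assumes "f = (\<lambda>x. h x - step h x + r x)" and "orth r"
  shows "f \<bullet> r = r \<bullet> r"
  using assms(2) unfolding assms(1)
  by (simp add: ip_linear orth_def ip_commute[of S mu h] ip_commute[of S mu "step h"])

text \<open>Applying powers of \<open>step\<close> to the decomposition of \<open>k\<close>
  telescopes, and by \<open>orth_fixed\<close> each remainder term contributes the constant
  \<open>f \<bullet> r\<close>. It is used for the centered function and again for its potential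
  \<open>h\<close>.\<close>

lemma sum_inner_steps:
  assumes "k = (\<lambda>x. h x - step h x + r x)" and "orth r"
  shows "(\<Sum>t\<le>N. f \<bullet> (step ^^ Suc t) k) =
    f \<bullet> step h - f \<bullet> (step ^^ Suc (Suc N)) h + real (Suc N) * (f \<bullet> r)"
proof -
  have e: "f \<bullet> (step ^^ Suc t) k = f \<bullet> (step ^^ Suc t) h - f \<bullet> (step ^^ Suc (Suc t)) h + f \<bullet> r" for t
  proof -
    have "(step ^^ Suc t) k = (\<lambda>x. (step ^^ Suc t) h x - (step ^^ Suc t) (step h) x + (step ^^ Suc t) r x)"
      unfolding assms(1) steps_add steps_diff ..
    moreover have "(step ^^ Suc t) (step h) = (step ^^ Suc (Suc t)) h"
      by (simp only: funpow_Suc_right o_apply)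
    ultimately show ?thesis by (simp only: ip_linear orth_fixed[OF assms(2)])
  qed
  show ?thesis
  proof (induction N)
    case 0
    show ?case using e[of 0] by simp
  next
    case (Suc N)
    then show ?case using e[of "Suc N"] by (simp add: algebra_simps)
  qed
qed

text \<open>With \<open>T = Suc N\<close>, the first two terms are the candidate limit, the third is
  a Cesaro mean of bounded terms, and the last grows linearly exactly when \<open>r\<close> is not
  null.\<close>

lemma scaled_var_avg_Suc:
  assumes f: "centered g = (\<lambda>x. h x - step h x + r x)" and r: "orth r"
  shows "real (Suc N) * var_avg S mu P g (Suc N) =
    2 * (centered g \<bullet> h) - centered g \<bullet> centered g
     - 2 / real (Suc N) * (\<Sum>t\<le>N. centered g \<bullet> (step ^^ Suc t) h) + real (N + 2) * (r \<bullet> r)"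
proof -
  let ?f = "centered g"
  \<comment> \<open>\<open>?D N\<close> is the variance of the path sum, that is
    \<open>T\<^sup>2\<close> times the variance of the average; its increments are those of
    \<open>path_exp_mu_square_Suc\<close>.\<close>
  let ?D = "\<lambda>N. path_exp mu N (\<lambda>xs. (path_sum g N xs)\<^sup>2) - (real (Suc N) * mean g)\<^sup>2"
  let ?a = "2 * (?f \<bullet> h) - ?f \<bullet> ?f"
  have fr: "?f \<bullet> r = r \<bullet> r" by (rule decomp_inner_remainder[OF f r])
  have ff: "?f \<bullet> ?f = ?f \<bullet> h - ?f \<bullet> step h + r \<bullet> r"
    using fr by (subst (2) f) (simp add: ip_linear)
  have D: "?D N = real (Suc N) * ?a - 2 * (\<Sum>t\<le>N. ?f \<bullet> (step ^^ Suc t) h)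
      + real (Suc N) * real (N + 2) * (r \<bullet> r)"
  proof (induction N)
    case 0
    show ?case using inner_steps_centered[of g 0] ff
      by (simp add: path_exp_mu_square_0)
  next
    case (Suc N)
    have "(\<Sum>t\<le>N. g \<bullet> (step ^^ Suc t) g) = (\<Sum>t\<le>N. ?f \<bullet> (step ^^ Suc t) ?f) + real (Suc N) * (mean g)\<^sup>2"
      by (simp only: inner_steps_centered[of g] sum.distrib) simp
    also have "(\<Sum>t\<le>N. ?f \<bullet> (step ^^ Suc t) ?f) =
        ?f \<bullet> step h - ?f \<bullet> (step ^^ Suc (Suc N)) h + real (Suc N) * (r \<bullet> r)"
      using sum_inner_steps[OF f r, of ?f N] fr by simp
    finally have s: "(\<Sum>t\<le>N. g \<bullet> (step ^^ Suc t) g) =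
        ?f \<bullet> step h - ?f \<bullet> (step ^^ Suc (Suc N)) h + real (Suc N) * (r \<bullet> r) + real (Suc N) * (mean g)\<^sup>2" .
    have "(\<Sum>t\<le>Suc N. ?f \<bullet> (step ^^ Suc t) h) =
        (\<Sum>t\<le>N. ?f \<bullet> (step ^^ Suc t) h) + ?f \<bullet> (step ^^ Suc (Suc N)) h"
      by simp
    moreover have "path_exp mu N (\<lambda>xs. (path_sum g N xs)\<^sup>2) = (real (Suc N) * mean g)\<^sup>2 + (real (Suc N) * ?a
        - 2 * (\<Sum>t\<le>N. ?f \<bullet> (step ^^ Suc t) h) + real (Suc N) * real (N + 2) * (r \<bullet> r))"
      using Suc.IH by linarith
    moreover have "g \<bullet> g = ?f \<bullet> ?f + (mean g)\<^sup>2" using inner_steps_centered[of g 0] by simp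
    moreover have "?f \<bullet> step h = ?f \<bullet> h - ?f \<bullet> ?f + r \<bullet> r" using ff by simp
    ultimately show ?case
      unfolding path_exp_mu_square_Suc s
      by (simp only: of_nat_Suc of_nat_add) (simp add: algebra_simps power2_eq_square)
  qed
  have "real (Suc N) * var_avg S mu P g (Suc N) = ?D N / real (Suc N)"
    unfolding var_avg_Suc by (simp add: power2_eq_square del: of_nat_Suc)
  also have "\<dots> = ?a - 2 / real (Suc N) * (\<Sum>t\<le>N. ?f \<bullet> (step ^^ Suc t) h) + real (N + 2) * (r \<bullet> r)"
    unfolding D by (simp add: add_divide_distrib diff_divide_distrib del: of_nat_Suc of_nat_add)
  finally show ?thesis .
qed

lemma asym_var_infinite:
  assumes f: "centered g = (\<lambda>x. h x - step h x + r x)" and r: "orth r" and R: "r \<bullet> r \<noteq> 0"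
  shows "asym_var S mu P g = \<infinity>"
proof -
  let ?f = "centered g"
  define B where "B = ?f \<bullet> ?f + h \<bullet> h"
  define a where "a = 2 * (?f \<bullet> h) - ?f \<bullet> ?f - 2 * B"
  have R0: "r \<bullet> r > 0" using R ip_nonneg[of S mu r] mu_nonneg by fastforce
  have lower: "a + real N * (r \<bullet> r) \<le> real (Suc N) * var_avg S mu P g (Suc N)" for N
  proof -
    have "(\<Sum>t\<le>N. ?f \<bullet> (step ^^ Suc t) h) \<le> (\<Sum>t\<le>N. B)"
      unfolding B_def by (rule sum_mono) (use inner_bound in \<open>smt (verit)\<close>)
    then have "2 / real (Suc N) * (\<Sum>t\<le>N. ?f \<bullet> (step ^^ Suc t) h) \<le> 2 / real (Suc N) * (real (Suc N) * B)"
      by (intro mult_left_mono) auto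
    then have "2 / real (Suc N) * (\<Sum>t\<le>N. ?f \<bullet> (step ^^ Suc t) h) \<le> 2 * B" by simp
    moreover have "real N * (r \<bullet> r) \<le> real (N + 2) * (r \<bullet> r)"
      using R0 by (intro mult_right_mono) auto
    ultimately show ?thesis unfolding scaled_var_avg_Suc[OF f r] a_def by linarith
  qed
  have "filterlim (\<lambda>N. a + real N * (r \<bullet> r)) at_top sequentially"
    using R0 by (intro filterlim_tendsto_add_at_top[OF tendsto_const]
        filterlim_at_top_mult_tendsto_pos[OF tendsto_const] filterlim_real_sequentially)
  then have "filterlim (\<lambda>N. real (Suc N) * var_avg S mu P g (Suc N)) at_top sequentially"
    by (rule filterlim_at_top_mono) (intro always_eventually allI lower)
  then have "(\<lambda>N. ereal (real (Suc N) * var_avg S mu P g (Suc N))) \<longlonglongrightarrow> \<infinity>"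
    by (simp only: tendsto_PInfty_eq_at_top)
  then have "(\<lambda>T. ereal (real T * var_avg S mu P g T)) \<longlonglongrightarrow> \<infinity>"
    by (rule LIMSEQ_imp_Suc)
  then show ?thesis unfolding asym_var_def by (rule limI)
qed

lemma asym_var_finite:
  assumes f: "centered g = (\<lambda>x. h x - step h x + r x)" and r: "orth r" and R: "r \<bullet> r = 0"
  shows "asym_var S mu P g = ereal (2 * (centered g \<bullet> h) - centered g \<bullet> centered g)"
proof -
  let ?f = "centered g"
  \<comment> \<open>Boundedness of the terms alone leaves the Cesaro mean of order 1. Decomposing
    \<open>h\<close> once more makes the sum telescope to a bounded quantity; the new remainder
    \<open>s\<close> is harmless, since the centered function lies in the range of
    \<open>I - step\<close> up to a null function.\<close>
  obtain k s where k: "h = (\<lambda>x. k x - step k x + s x)" and s: "orth s"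
    using decomposition by blast
  have "?f \<bullet> s = 0"
    unfolding f using s ip_null(2)[OF mu_nonneg R, of s]
    by (simp add: ip_linear orth_def ip_commute[of S mu h] ip_commute[of S mu "step h"])
  then have sum: "(\<Sum>t\<le>N. ?f \<bullet> (step ^^ Suc t) h) = ?f \<bullet> step k - ?f \<bullet> (step ^^ Suc (Suc N)) k" for N
    using sum_inner_steps[OF k s, of ?f N] by simp
  define B where "B = ?f \<bullet> ?f + k \<bullet> k"
  have B: "\<bar>\<Sum>t\<le>N. ?f \<bullet> (step ^^ Suc t) h\<bar> \<le> 2 * B" for N
    unfolding sum B_def using inner_bound[of ?f 1 k] inner_bound[of ?f "Suc (Suc N)" k] by simp
  have "(\<lambda>N. 2 / real (Suc N) * (\<Sum>t\<le>N. ?f \<bullet> (step ^^ Suc t) h)) \<longlonglongrightarrow> 0"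
  proof (rule tendsto_0_le)
    show "\<forall>\<^sub>F N in sequentially.
        norm (2 / real (Suc N) * (\<Sum>t\<le>N. ?f \<bullet> (step ^^ Suc t) h)) \<le> norm (4 * B / real (Suc N)) * 1"
    proof (intro always_eventually allI)
      fix N
      have "norm (2 / real (Suc N) * (\<Sum>t\<le>N. ?f \<bullet> (step ^^ Suc t) h)) =
          2 / real (Suc N) * \<bar>\<Sum>t\<le>N. ?f \<bullet> (step ^^ Suc t) h\<bar>"
        by (simp only: real_norm_def abs_mult) simp
      also have "\<dots> \<le> 2 / real (Suc N) * (2 * B)"
        by (intro mult_left_mono B) auto
      also have "\<dots> \<le> norm (4 * B / real (Suc N)) * 1"
        by (simp add: divide_right_mono)
      finally show "norm (2 / real (Suc N) * (\<Sum>t\<le>N. ?f \<bullet> (step ^^ Suc t) h)) \<le> norm (4 * B / real (Suc N)) * 1" .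
    qed
    show "(\<lambda>N. 4 * B / real (Suc N)) \<longlonglongrightarrow> 0"
      using LIMSEQ_Suc[OF lim_const_over_n[of "4 * B"]] by simp
  qed
  then have "(\<lambda>N. 2 * (?f \<bullet> h) - ?f \<bullet> ?f
      - 2 / real (Suc N) * (\<Sum>t\<le>N. ?f \<bullet> (step ^^ Suc t) h)) \<longlonglongrightarrow> 2 * (?f \<bullet> h) - ?f \<bullet> ?f - 0"
    by (intro tendsto_diff tendsto_const)
  then have "(\<lambda>N. real (Suc N) * var_avg S mu P g (Suc N)) \<longlonglongrightarrow> 2 * (?f \<bullet> h) - ?f \<bullet> ?f"
    unfolding scaled_var_avg_Suc[OF f r] using R by simp
  then have "(\<lambda>N. ereal (real (Suc N) * var_avg S mu P g (Suc N))) \<longlonglongrightarrow> ereal (2 * (?f \<bullet> h) - ?f \<bullet> ?f)"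
    by (rule tendsto_ereal)
  then have "(\<lambda>T. ereal (real T * var_avg S mu P g T)) \<longlonglongrightarrow> ereal (2 * (?f \<bullet> h) - ?f \<bullet> ?f)"
    by (rule LIMSEQ_imp_Suc)
  then show ?thesis unfolding asym_var_def by (rule limI)
qed

end

section \<open>Reversible chains, their energy form and the comparison\<close>

locale reversible_chain = stationary_chain S mu P
  for S :: "'s set" and mu :: "'s \<Rightarrow> real" and P :: "'s \<Rightarrow> 's \<Rightarrow> real" +
  assumes balance: "x \<in> S \<Longrightarrow> y \<in> S \<Longrightarrow> mu x * P x y = mu y * P y x"
begin

lemma step_adjoint: "f \<bullet> step g = step f \<bullet> g"
proof -
  have "f \<bullet> step g = (\<Sum>y\<in>S. \<Sum>x\<in>S. mu x * P x y * (f x * g y))"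
    by (subst sum.swap) (simp add: ip_def kstep_def sum_distrib_left algebra_simps)
  also have "\<dots> = (\<Sum>y\<in>S. \<Sum>x\<in>S. mu y * P y x * (f x * g y))"
    by (intro sum.cong) (auto simp: balance)
  also have "\<dots> = step f \<bullet> g"
    by (simp add: ip_def kstep_def sum_distrib_left sum_distrib_right algebra_simps)
  finally show ?thesis .
qed

definition energy :: "('s \<Rightarrow> real) \<Rightarrow> ('s \<Rightarrow> real) \<Rightarrow> real" where
  "energy f g = f \<bullet> g - f \<bullet> step g"

lemma energy_add_scaled:
  "energy (\<lambda>x. f x + t * g x) (\<lambda>x. f x + t * g x) = energy f f + 2 * t * energy g f + t\<^sup>2 * energy g g"
  using step_adjoint[of f g]
  by (simp add: energy_def ip_linear kstep_linear algebra_simps power2_eq_square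
      ip_commute[of S mu g f] ip_commute[of S mu "step f" g])

lemma energy_nonneg: "energy f f \<ge> 0"
  using dirichlet_nonneg by (simp add: energy_def)

text \<open>The degenerate case of Cauchy-Schwarz for the energy, a symmetric nonnegative form by
  reversibility.\<close>

lemma energy_null: "energy f f = 0 \<Longrightarrow> energy g f = 0"
  using form_null[of "energy f f" "energy g f" "energy g g"] energy_nonneg
  unfolding energy_add_scaled[symmetric] by blast

end

text \<open>Both asymptotic variances have the form \<open>2 \<langle>f, (I - P)\<inverse> f\<rangle> - \<langle>f, f\<rangle>\<close>; the term with the
  inverse is compared by the variational principle
  \<open>\<langle>f, (I - R)\<inverse> f\<rangle> = sup\<^sub>\<phi> 2 \<langle>f, \<phi>\<rangle> - \<langle>\<phi>, (I - R) \<phi>\<rangle>\<close> for the reversible kernel,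
  tested at \<open>bar u / c\<close> where \<open>u = (I - P)\<inverse> f\<close>.\<close>

lemma asym_var_comparison:
  fixes pr :: "'s \<Rightarrow> 't" and bar :: "('s \<Rightarrow> real) \<Rightarrow> 't \<Rightarrow> real"
  assumes "stationary_chain S mu P" and "reversible_chain S' nu R" and c: "c > 0"
    and marg: "\<And>F. (\<Sum>x\<in>S. mu x * F (pr x)) = (\<Sum>y\<in>S'. nu y * F y)"
    and bar: "\<And>F u. ip S mu (\<lambda>x. F (pr x)) u = ip S' nu F (bar u)"
    and energy_le: "\<And>u. ip S' nu (bar u) (bar u) - ip S' nu (bar u) (kstep S' R (bar u))
          \<le> c * (ip S mu u u - ip S mu u (kstep S P u))"
  shows "asym_var S mu P (\<lambda>x. g (pr x)) \<le>
    ereal c * asym_var S' nu R g + ereal ((c - 1) * var_dist S' nu g)"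
proof -
  interpret P: stationary_chain S mu P by fact
  interpret R: reversible_chain S' nu R by fact
  let ?f = "P.centered (\<lambda>x. g (pr x))" and ?f' = "R.centered g"
  have f: "?f = (\<lambda>x. ?f' (pr x))"
    using marg[of g] by (simp add: P.centered_def R.centered_def P.mean_def R.mean_def)
  have ff: "ip S mu ?f ?f = ip S' nu ?f' ?f'"
    using marg[of "\<lambda>y. ?f' y * ?f' y"] unfolding f by (simp add: ip_def)
  have fbar: "ip S mu ?f u = ip S' nu ?f' (bar u)" for u
    unfolding f by (rule bar)
  obtain w r' where w: "?f' = (\<lambda>x. w x - kstep S' R w x + r' x)" and r': "R.orth r'"
    using R.decomposition by blast
  obtain u r where u: "?f = (\<lambda>x. u x - kstep S P u x + r x)" and r: "P.orth r"
    using P.decomposition by blast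
  show ?thesis
  proof (cases "ip S' nu r' r' = 0")
    case False
    from R.asym_var_infinite[OF w r' False] c show ?thesis by simp
  next
    case True
    have f'_inner: "ip S' nu ?f' k = R.energy w k" for k
      unfolding w R.energy_def using ip_null(2)[OF R.mu_nonneg True, of k] R.step_adjoint[of w k]
      by (simp add: ip_linear)
    \<comment> \<open>Finiteness passes from \<open>R\<close> to \<open>P\<close>: \<open>r\<close>
      has zero energy under \<open>P\<close>, so \<open>bar r\<close> has zero energy under
      \<open>R\<close> and pairs to 0 with \<open>?f'\<close>, which is a pairing with
      \<open>w\<close> in the energy. As \<open>?f\<close> pairs with \<open>r\<close> to the square
      norm of \<open>r\<close>, the remainder \<open>r\<close> is null.\<close>
    have "R.energy (bar r) (bar r) \<le> c * (ip S mu r r - ip S mu r (kstep S P r))"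
      using energy_le[of r] by (simp add: R.energy_def)
    also have "\<dots> = 0" using r by (simp add: P.orth_def)
    finally have "R.energy (bar r) (bar r) = 0" using R.energy_nonneg by (metis order_antisym)
    then have "ip S mu ?f r = 0" unfolding fbar f'_inner by (rule R.energy_null)
    then have null: "ip S mu r r = 0" using P.decomp_inner_remainder[OF u r] by simp
    have "ip S mu ?f u = ip S mu u u - ip S mu u (kstep S P u)"
      using ip_null(2)[OF P.mu_nonneg null, of u]
      by (subst u) (simp add: ip_linear ip_commute[of S mu "kstep S P u"])
    then have e1: "R.energy (bar u) (bar u) \<le> c * R.energy w (bar u)"
      using energy_le[of u] fbar[of u] f'_inner[of "bar u"] by (simp add: R.energy_def)
    \<comment> \<open>This is the variational inequality at \<open>bar u / c\<close>, multiplied by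
      \<open>c\<^sup>2\<close> to avoid quotients.\<close>
    have "0 \<le> R.energy (\<lambda>x. bar u x + (- c) * w x) (\<lambda>x. bar u x + (- c) * w x)"
      by (rule R.energy_nonneg)
    also have "\<dots> = R.energy (bar u) (bar u) - 2 * c * R.energy w (bar u) + c * c * R.energy w w"
      unfolding R.energy_add_scaled by (simp add: power2_eq_square)
    finally have "0 \<le> c * (c * R.energy w w - R.energy w (bar u))"
      using e1 by (simp add: algebra_simps)
    then have "R.energy w (bar u) \<le> c * R.energy w w"
      using c by (simp add: zero_le_mult_iff)
    \<comment> \<open>The factor \<open>c\<close> acts on the pairing with the potential but not on
      the subtracted square norm; compensating for this produces the summand with
      \<open>c - 1\<close>.\<close>
    then have "2 * ip S mu ?f u - ip S mu ?f ?f \<le>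
        c * (2 * ip S' nu ?f' w - ip S' nu ?f' ?f') + (c - 1) * ip S' nu ?f' ?f'"
      unfolding ff fbar[of u] f'_inner[of w] f'_inner[of "bar u"] by (simp add: algebra_simps)
    then show ?thesis
      using P.asym_var_finite[OF u r null] R.asym_var_finite[OF w r' True]
      by (simp add: R.var_dist_centered)
  qed
qed

section \<open>The marginal Gibbs and the reversible kernel\<close>

lemma sum_ind:
  assumes "finite A" and "x \<in> A"
  shows "(\<Sum>y\<in>A. f y * ind (y = x)) = f x" and "(\<Sum>y\<in>A. ind (y = x) * f y) = f x"
    and "(\<Sum>y\<in>A. ind (y = x)) = 1"
  using assms by (simp_all add: ind_def if_distrib[of "(*) _"] if_distrib[of "\<lambda>t. t * _"] cong: if_cong)

lemma ind_nonneg: "ind b \<ge> 0"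
  by (simp add: ind_def)

lemma ind_conj: "ind (a \<and> b) = ind a * ind b"
  by (simp add: ind_def)

lemma ncount_pos: "i \<in> {1..n} \<Longrightarrow> ncount n c (c i) > 0"
  by (auto simp: ncount_def card_gt_0_iff)

lemma ncount_upd_new: "i \<in> {1..n} \<Longrightarrow> c i \<noteq> k \<Longrightarrow> ncount n (c(i := k)) k = Suc (ncount n c k)"
proof -
  assume i: "i \<in> {1..n}" "c i \<noteq> k"
  then have "{j \<in> {1..n}. (c(i := k)) j = k} = insert i {j \<in> {1..n}. c j = k}" by auto
  then show ?thesis using i by (simp add: ncount_def)
qed

lemma ncount_upd_old: "i \<in> {1..n} \<Longrightarrow> c i \<noteq> k \<Longrightarrow> ncount n c (c i) = Suc (ncount n (c(i := k)) (c i))"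
  using ncount_upd_new[of i n "c(i := k)" "c i"] by simp

text \<open>The restriction to \<open>Kpairs K\<close> keeps the result extensional, hence inside
  \<open>velocities K\<close>.\<close>

definition vneg :: "nat \<Rightarrow> velocity \<Rightarrow> velocity" where
  "vneg K v = (\<lambda>p\<in>Kpairs K. - v p)"

text \<open>On the selected pair this is the label left by the item, on the swapped pair the label
  entered.\<close>

definition vel_from :: "nat \<times> nat \<Rightarrow> int \<Rightarrow> nat" where
  "vel_from p s = (if s = 1 then fst p else snd p)"

text \<open>Accepted and rejected parts are separated because time reversal treats them differently:
  a move is reversed by exchanging the two labels, a rejection stays in place and only affects the
  velocity. \<open>P_R\<close> and \<open>P_NR\<close> share both parts.\<close>

definition move :: "nat \<Rightarrow> nat \<Rightarrow> (config \<Rightarrow> real) \<Rightarrow> config \<Rightarrow> nat \<Rightarrow> nat \<Rightarrow> config \<Rightarrow> real" where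
  "move K n pd c km kp c' = (\<Sum>i\<in>{i \<in> {1..n}. c i = km}.
     (1 / real (ncount n c km)) * acc K n pd c i km kp * ind (c' = c(i := kp)))"

definition reject :: "nat \<Rightarrow> nat \<Rightarrow> (config \<Rightarrow> real) \<Rightarrow> config \<Rightarrow> nat \<Rightarrow> nat \<Rightarrow> real" where
  "reject K n pd c km kp = (if ncount n c km = 0 then 1 else
     (\<Sum>i\<in>{i \<in> {1..n}. c i = km}. (1 / real (ncount n c km)) * (1 - acc K n pd c i km kp)))"

lemma R_step_move:
  "R_step K n pd c km kp c' = move K n pd c km kp c' + reject K n pd c km kp * ind (c' = c)"
proof (cases "ncount n c km = 0")
  case True
  then show ?thesis by (simp add: R_step_def move_def reject_def)
next
  case False
  then show ?thesis
    by (simp add: R_step_def move_def reject_def sum_distrib_left sum.distrib sum_subtractf algebra_simps)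
qed

lemma NR_core_move:
  "NR_core K n pd k k' (c, v) (c', v') =
    (let km = vel_from (k, k') (v (k, k')); kp = vel_from (k', k) (v (k, k')) in
      move K n pd c km kp c' * ind (v' = v)
      + reject K n pd c km kp * ind (c' = c) * ind (v' = vflip (k, k') v))"
proof -
  define km where "km = vel_from (k, k') (v (k, k'))"
  define kp where "kp = vel_from (k', k) (v (k, k'))"
  have "NR_core K n pd k k' (c, v) (c', v') =
      (if ncount n c km = 0 then ind (c' = c \<and> v' = vflip (k, k') v)
         else (\<Sum>i\<in>{i \<in> {1..n}. c i = km}.
                 (1 / real (ncount n c km)) *
                 (acc K n pd c i km kp * ind (c' = c(i := kp) \<and> v' = v)
                  + (1 - acc K n pd c i km kp) * ind (c' = c \<and> v' = vflip (k, k') v))))"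
    by (simp add: NR_core_def km_def kp_def vel_from_def Let_def)
  also have "\<dots> = move K n pd c km kp c' * ind (v' = v)
      + reject K n pd c km kp * ind (c' = c) * ind (v' = vflip (k, k') v)"
  proof (cases "ncount n c km = 0")
    case True
    then show ?thesis by (simp add: move_def reject_def ind_conj)
  next
    case False
    then show ?thesis
      by (simp add: move_def reject_def ind_conj sum_distrib_left sum.distrib sum_subtractf algebra_simps)
  qed
  finally show ?thesis by (simp add: km_def kp_def Let_def)
qed

locale mixture_posterior =
  fixes K n :: nat and pd :: "config \<Rightarrow> real" and xi :: real
  assumes K2: "K \<ge> 2" and n1: "n \<ge> 1"
    and pd_nonneg: "c \<in> configs K n \<Longrightarrow> pd c \<ge> 0"
    and pd_total: "(\<Sum>c\<in>configs K n. pd c) = 1"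
    and xi: "0 \<le> xi" "xi \<le> real n"
begin

abbreviation "C \<equiv> configs K n"
abbreviation "V \<equiv> velocities K"
abbreviation "KP \<equiv> Kpairs K"
abbreviation "neg \<equiv> vneg K"
abbreviation "q \<equiv> xi / real n"

lemma finite_C: "finite C"
  by (auto simp: configs_def intro!: finite_PiE)

lemma finite_KP: "finite KP"
  by (rule finite_subset[of _ "{1..K} \<times> {1..K}"]) (auto simp: Kpairs_def)

lemma finite_V: "finite V"
  by (auto simp: velocities_def intro!: finite_PiE finite_KP)

lemma card_V: "card V = 2 ^ card KP"
  by (simp add: velocities_def card_PiE finite_KP numeral_2_eq_2)

lemma C_upd: "c \<in> C \<Longrightarrow> i \<in> {1..n} \<Longrightarrow> k \<in> {1..K} \<Longrightarrow> c(i := k) \<in> C"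
  unfolding configs_def by (metis PiE_fun_upd insert_absorb)

lemma C_val: "c \<in> C \<Longrightarrow> i \<in> {1..n} \<Longrightarrow> c i \<in> {1..K}"
  by (auto simp: configs_def)

lemma q01: "0 \<le> q" "q \<le> 1"
  using xi n1 by auto

lemma cond_nonneg: "c \<in> C \<Longrightarrow> i \<in> {1..n} \<Longrightarrow> k \<in> {1..K} \<Longrightarrow> cond K pd c i k \<ge> 0"
  unfolding cond_def by (intro divide_nonneg_nonneg sum_nonneg pd_nonneg C_upd) auto

lemma normalizer_ge: "c \<in> C \<Longrightarrow> i \<in> {1..n} \<Longrightarrow> k \<in> {1..K} \<Longrightarrow>
    pd (c(i := k)) \<le> (\<Sum>j\<in>{1..K}. pd (c(i := j)))"
  by (rule member_le_sum) (auto intro!: pd_nonneg C_upd)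

lemma cond_le_1: "c \<in> C \<Longrightarrow> i \<in> {1..n} \<Longrightarrow> k \<in> {1..K} \<Longrightarrow> cond K pd c i k \<le> 1"
  using normalizer_ge[of c i k] pd_nonneg[OF C_upd[of c i k]]
  by (auto simp: cond_def divide_le_eq_1)

lemma acc_nonneg:
  "c \<in> C \<Longrightarrow> i \<in> {1..n} \<Longrightarrow> km \<in> {1..K} \<Longrightarrow> kp \<in> {1..K} \<Longrightarrow> acc K n pd c i km kp \<ge> 0"
  by (simp add: acc_def ratio_def cond_nonneg)

lemma acc_le_1: "acc K n pd c i km kp \<le> 1"
  by (simp add: acc_def)

lemma move_nonneg: "c \<in> C \<Longrightarrow> km \<in> {1..K} \<Longrightarrow> kp \<in> {1..K} \<Longrightarrow> move K n pd c km kp c' \<ge> 0"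
  unfolding move_def by (intro sum_nonneg mult_nonneg_nonneg acc_nonneg ind_nonneg) auto

lemma reject_nonneg: "reject K n pd c km kp \<ge> 0"
  unfolding reject_def by (auto intro!: sum_nonneg simp: acc_le_1)

lemma R_step_nonneg: "c \<in> C \<Longrightarrow> km \<in> {1..K} \<Longrightarrow> kp \<in> {1..K} \<Longrightarrow> R_step K n pd c km kp c' \<ge> 0"
  unfolding R_step_move by (intro add_nonneg_nonneg mult_nonneg_nonneg move_nonneg reject_nonneg ind_nonneg)

lemma R_step_row_sum:
  assumes c: "c \<in> C" and kp: "kp \<in> {1..K}"
  shows "(\<Sum>c'\<in>C. R_step K n pd c km kp c') = 1"
proof -
  let ?I = "{i \<in> {1..n}. c i = km}"
  have "(\<Sum>c'\<in>C. move K n pd c km kp c') =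
      (\<Sum>i\<in>?I. \<Sum>c'\<in>C. (1 / real (ncount n c km)) * acc K n pd c i km kp * ind (c' = c(i := kp)))"
    unfolding move_def by (rule sum.swap)
  also have "\<dots> = (\<Sum>i\<in>?I. (1 / real (ncount n c km)) * acc K n pd c i km kp)"
    by (intro sum.cong refl) (subst sum_ind(1), auto simp: finite_C intro!: C_upd c kp)
  finally have 1: "(\<Sum>c'\<in>C. R_step K n pd c km kp c') =
      (\<Sum>i\<in>?I. (1 / real (ncount n c km)) * acc K n pd c i km kp) + reject K n pd c km kp"
    by (simp add: R_step_move sum.distrib sum_ind[OF finite_C c])
  show ?thesis
  proof (cases "ncount n c km = 0")
    case True
    then show ?thesis unfolding 1 by (simp add: reject_def)
  next
    case False
    have "(\<Sum>i\<in>?I. (1 / real (ncount n c km)) * acc K n pd c i km kp) + reject K n pd c km kp =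
        (\<Sum>i\<in>?I. 1 / real (ncount n c km))"
      using False by (simp add: reject_def diff_divide_distrib sum_subtractf)
    then show ?thesis using False unfolding 1 by (simp add: ncount_def)
  qed
qed

text \<open>Metropolis-Hastings: both conditionals have the same normalizer, and
  \<open>n_{k_+}(c) + 1\<close> is the count of \<open>kp\<close> after the move, so the count
  quotient in \<open>ratio\<close> corrects exactly for the uniform choices of \<open>i\<close>
  before and after. On the support both sides are \<open>min (x / a) (y / b)\<close>.\<close>

lemma acc_balance:
  assumes c: "c \<in> C" "i \<in> {1..n}" and k: "kp \<in> {1..K}" "c i \<noteq> kp"
  defines "c' \<equiv> c(i := kp)"
  shows "pd c * (1 / real (ncount n c (c i)) * acc K n pd c i (c i) kp) =
    pd c' * (1 / real (ncount n c' kp) * acc K n pd c' i kp (c i))"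
proof -
  define a b x y where "a = real (ncount n c (c i))" "b = real (ncount n c' kp)" "x = pd c" "y = pd c'"
  have ab: "a > 0" "b > 0"
    using ncount_pos[OF c(2), of c] ncount_pos[OF c(2), of c'] by (auto simp: a_b_x_y_def c'_def)
  have b: "b = real (ncount n c kp + 1)" and a: "a = real (ncount n c' (c i) + 1)"
    using ncount_upd_new[OF c(2), of c kp] ncount_upd_old[OF c(2), of c kp] k(2) by (auto simp: a_b_x_y_def c'_def)
  define Z where "Z = (\<Sum>j\<in>{1..K}. pd (c(i := j)))"
  have upd: "c(i := c i) = c" "c'(i := c i) = c" "c'(i := kp) = c'" "\<And>j. c'(i := j) = c(i := j)"
    by (auto simp: c'_def)
  have xy: "0 \<le> x" "0 \<le> y" "x \<le> Z" "y \<le> Z"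
    using pd_nonneg[OF c(1)] pd_nonneg[OF C_upd[OF c k(1)]] normalizer_ge[OF c C_val[OF c]] normalizer_ge[OF c k(1)]
    by (auto simp: a_b_x_y_def Z_def c'_def)
  have r: "acc K n pd c i (c i) kp = min 1 (a / b * (y / Z / (x / Z)))"
    "acc K n pd c' i kp (c i) = min 1 (b / a * (x / Z / (y / Z)))"
    using a b by (auto simp: acc_def ratio_def cond_def upd Z_def a_b_x_y_def c'_def[symmetric])
  have "x * (1 / a * min 1 (a / b * (y / Z / (x / Z)))) = y * (1 / b * min 1 (b / a * (x / Z / (y / Z))))"
  \<comment> \<open>If one weight vanishes, both sides are 0: one through its prefactor, the other
    through the numerator of its acceptance ratio.\<close>
  proof (cases "x = 0 \<or> y = 0")
    case True
    then show ?thesis by auto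
  next
    case False
    then have "x > 0" "y > 0" "Z > 0" using xy by auto
    then show ?thesis using ab by (simp add: min_def field_simps)
  qed
  then show ?thesis unfolding r by (simp add: a_b_x_y_def)
qed

lemma ncount_pair_upd:
  assumes "i \<in> {1..n}" "c i = km" "km \<noteq> kp"
  shows "ncount n (c(i := kp)) km + ncount n (c(i := kp)) kp = ncount n c km + ncount n c kp"
  using ncount_upd_new[of i n c kp] ncount_upd_old[of i n c kp] assms by simp

text \<open>The pair weight depends only on the sum of the two counts, which a move between these
  labels preserves, so the balance of the acceptance step is inherited item by item.\<close>

lemma move_balance:
  assumes c: "c \<in> C" "c' \<in> C" and k: "km \<in> {1..K}" "kp \<in> {1..K}" "km \<noteq> kp"
  shows "pd c * (pc K n c km kp * move K n pd c km kp c') = pd c' * (pc K n c' km kp * move K n pd c' kp km c)"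
proof -
  let ?t = "\<lambda>c km kp i. 1 / real (ncount n c km) * acc K n pd c i km kp"
  \<comment> \<open>The index sets on the two sides differ; putting the condition on
    \<open>c i\<close> into the indicator lets both sums run over all items.\<close>
  have ext: "move K n pd c km kp c' = (\<Sum>i\<in>{1..n}. ?t c km kp i * ind (c i = km \<and> c' = c(i := kp)))" for c c' km kp
    unfolding move_def by (rule sum.mono_neutral_cong_left) (auto simp: ind_def)
  have "pd c * (pc K n c km kp * (?t c km kp i * ind (c i = km \<and> c' = c(i := kp)))) =
      pd c' * (pc K n c' km kp * (?t c' kp km i * ind (c' i = kp \<and> c = c'(i := km))))"
    if i: "i \<in> {1..n}" for i
  proof (cases "c i = km \<and> c' = c(i := kp)")
    case True
    then have "c' i = kp \<and> c = c'(i := km)" by auto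
    moreover have "pc K n c' km kp = pc K n c km kp"
      using ncount_pair_upd[OF i, of c km kp] True k by (simp add: pc_def of_nat_add[symmetric] del: of_nat_add)
    ultimately show ?thesis
      using arg_cong[OF acc_balance[OF c(1) i k(2)], of "(*) (pc K n c km kp)"] True k(3)
      by (simp add: ind_def mult_ac)
  next
    case False
    then have "\<not> (c' i = kp \<and> c = c'(i := km))" by auto
    with False show ?thesis by (simp only: ind_def if_False mult_zero_right)
  qed
  then show ?thesis unfolding ext sum_distrib_left by (intro sum.cong refl)
qed

lemma KP_mem: "p \<in> KP \<Longrightarrow> fst p \<in> {1..K} \<and> snd p \<in> {1..K} \<and> fst p < snd p"
  by (auto simp: Kpairs_def)

lemma pc_commute: "pc K n c k k' = pc K n c k' k"
  by (simp add: pc_def add.commute)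

lemma pc_nonneg: "pc K n c k k' \<ge> 0"
  by (simp add: pc_def)

lemma ncount_total: "c \<in> C \<Longrightarrow> (\<Sum>k\<in>{1..K}. ncount n c k) = n"
proof -
  assume c: "c \<in> C"
  have "n = (\<Sum>i\<in>{1..n}. 1)" by simp
  also have "\<dots> = (\<Sum>k\<in>{1..K}. \<Sum>i\<in>{i \<in> {1..n}. c i = k}. 1)"
    by (rule sum.group[symmetric]) (use C_val[OF c] in auto)
  finally show ?thesis by (simp add: ncount_def)
qed

text \<open>Each label belongs to \<open>K - 1\<close> pairs, so the counts add up to
  \<open>(K - 1) n\<close>.\<close>

lemma pc_total:
  assumes "c \<in> C"
  shows "(\<Sum>(k, k')\<in>KP. pc K n c k k') = 1"
proof -
  let ?m = "\<lambda>k. real (ncount n c k)"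
  have KP: "(\<Sum>(k, k')\<in>KP. f k k') = (\<Sum>k\<in>{1..K}. \<Sum>k'\<in>{1..K}. if k < k' then f k k' else 0)"
    for f :: "nat \<Rightarrow> nat \<Rightarrow> real"
    unfolding sum.cartesian_product
    by (rule sum.mono_neutral_cong_left) (auto simp: Kpairs_def split: if_splits)
  have "(\<Sum>(k, k')\<in>KP. ?m k') = (\<Sum>k\<in>{1..K}. \<Sum>k'\<in>{1..K}. if k' < k then ?m k else 0)"
    unfolding KP by (rule sum.swap)
  then have "(\<Sum>(k, k')\<in>KP. ?m k + ?m k') =
      (\<Sum>k\<in>{1..K}. \<Sum>k'\<in>{1..K}. (if k < k' then ?m k else 0) + (if k' < k then ?m k else 0))"
    using KP[of "\<lambda>k k'. ?m k"] by (simp add: split_def sum.distrib)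
  also have "\<dots> = (\<Sum>k\<in>{1..K}. \<Sum>k'\<in>{1..K} - {k}. ?m k)"
    by (intro sum.cong refl sum.mono_neutral_cong_right) auto
  also have "\<dots> = real (K - 1) * (\<Sum>k\<in>{1..K}. ?m k)"
    by (simp add: sum_distrib_left)
  also have "(\<Sum>k\<in>{1..K}. ?m k) = real n"
    using ncount_total[OF assms] by (metis of_nat_sum)
  finally show ?thesis
    using K2 n1 by (simp add: pc_def split_def sum_divide_distrib[symmetric])
qed

lemma P_R_reversible: "reversible_chain C pd (P_R K n pd)"
proof -
  have bal: "pd c * P_R K n pd c c' = pd c' * P_R K n pd c' c" if c: "c \<in> C" "c' \<in> C" for c c'
  proof (cases "c = c'")
    case False
    have "pd c * (pc K n c k k' * (1/2 * R_step K n pd c k k' c' + 1/2 * R_step K n pd c k' k c')) =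
      pd c' * (pc K n c' k k' * (1/2 * R_step K n pd c' k k' c + 1/2 * R_step K n pd c' k' k c))"
      if "(k, k') \<in> KP" for k k'
      using move_balance[OF c, of k k'] move_balance[OF c, of k' k] KP_mem[OF that] False
      by (simp add: R_step_move ind_def pc_commute[of _ k' k] algebra_simps)
    then show ?thesis unfolding P_R_def sum_distrib_left by (intro sum.cong) auto
  qed simp
  have row: "(\<Sum>c'\<in>C. P_R K n pd c c') = 1" if c: "c \<in> C" for c
  proof -
    have "(\<Sum>c'\<in>C. P_R K n pd c c') = (\<Sum>(k, k')\<in>KP. \<Sum>c'\<in>C.
        pc K n c k k' * (1/2 * R_step K n pd c k k' c' + 1/2 * R_step K n pd c k' k c'))"
      unfolding P_R_def split_def by (rule sum.swap)
    also have "\<dots> = (\<Sum>(k, k')\<in>KP. pc K n c k k')"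
      using KP_mem by (intro sum.cong refl)
        (auto simp: sum_distrib_left[symmetric] sum.distrib R_step_row_sum[OF c] sum_divide_distrib[symmetric])
    finally show ?thesis using pc_total[OF c] by simp
  qed
  show ?thesis
  proof
    fix c c' assume "c \<in> C" "c' \<in> C"
    then show "P_R K n pd c c' \<ge> 0"
      unfolding P_R_def using KP_mem
      by (auto intro!: sum_nonneg mult_nonneg_nonneg add_nonneg_nonneg pc_nonneg R_step_nonneg)
  next
    fix c' assume c': "c' \<in> C"
    have "(\<Sum>c\<in>C. pd c * P_R K n pd c c') = (\<Sum>c\<in>C. pd c' * P_R K n pd c' c)"
      by (intro sum.cong bal c' refl)
    then show "(\<Sum>c\<in>C. pd c * P_R K n pd c c') = pd c'"
      by (simp add: sum_distrib_left[symmetric] row c')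
  qed (auto simp: finite_C pd_nonneg pd_total bal row)
qed

text \<open>Off the support of \<open>pd\<close> the rows of \<open>P_MG\<close> need not sum to 1 (all conditionals may be \<open>0 / 0\<close>),
  so there the kernel is replaced by the identity.\<close>

definition P_MG_full :: "config \<Rightarrow> config \<Rightarrow> real" where
  "P_MG_full c c' = (if pd c = 0 then ind (c' = c) else P_MG K n pd c c')"

lemma P_MG_off_support:
  assumes "pd c' = 0"
  shows "P_MG K n pd c c' = 0"
proof -
  have "ind (c' = c(i := c' i)) * cond K pd c i (c' i) = 0" for i
  proof (cases "c' = c(i := c' i)")
    case True
    then have "pd (c(i := c' i)) = 0" using assms by metis
    then show ?thesis by (simp add: cond_def)
  qed (simp add: ind_def)
  then show ?thesis by (auto simp: P_MG_def intro!: sum.neutral)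
qed

lemma asym_var_P_MG_full: "asym_var C pd (P_MG K n pd) g = asym_var C pd P_MG_full g"
  by (rule asym_var_cong) (auto simp: P_MG_full_def P_MG_off_support)

lemma P_MG_row_sum:
  assumes c: "c \<in> C" and pos: "pd c \<noteq> 0"
  shows "(\<Sum>c'\<in>C. P_MG K n pd c c') = 1"
proof -
  have "(\<Sum>c'\<in>C. ind (c' = c(i := c' i)) * cond K pd c i (c' i)) = 1" if i: "i \<in> {1..n}" for i
  proof -
    have "(\<Sum>c'\<in>C. ind (c' = c(i := c' i)) * cond K pd c i (c' i)) =
        (\<Sum>c'\<in>(\<lambda>k. c(i := k)) ` {1..K}. cond K pd c i (c' i))"
    proof (rule sum.mono_neutral_cong_right)
      show "\<forall>c'\<in>C - (\<lambda>k. c(i := k)) ` {1..K}. ind (c' = c(i := c' i)) * cond K pd c i (c' i) = 0"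
        using C_val[OF _ i] by (auto simp: ind_def)
    qed (auto simp: finite_C ind_def intro!: C_upd[OF c i])
    also have "\<dots> = (\<Sum>k\<in>{1..K}. cond K pd c i k)"
      by (subst sum.reindex) (auto simp: inj_on_def fun_upd_eqD)
    also have "\<dots> = 1"
      using normalizer_ge[OF c i C_val[OF c i]] pos pd_nonneg[OF c]
      by (simp add: cond_def sum_divide_distrib[symmetric])
    finally show ?thesis .
  qed
  then have "(\<Sum>i\<in>{1..n}. \<Sum>c'\<in>C. ind (c' = c(i := c' i)) * cond K pd c i (c' i)) = real n"
    by simp
  then show ?thesis
    using n1 unfolding P_MG_def sum_distrib_left[symmetric] by (subst sum.swap) simp
qed

text \<open>Configurations that agree off \<open>i\<close> share the normalizer of the conditional
  at \<open>i\<close>, so \<open>pd c\<close> times the conditional weight of \<open>c'\<close> is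
  symmetric in \<open>c\<close> and \<open>c'\<close>.\<close>

lemma P_MG_reversible: "reversible_chain C pd P_MG_full"
proof -
  have row: "(\<Sum>c'\<in>C. P_MG_full c c') = 1" if "c \<in> C" for c
    using P_MG_row_sum[OF that] sum_ind(3)[OF finite_C that] by (cases "pd c = 0") (simp_all add: P_MG_full_def)
  have bal: "pd c * P_MG K n pd c c' = pd c' * P_MG K n pd c' c" for c c'
  proof -
    have "pd c * (ind (c' = c(i := c' i)) * cond K pd c i (c' i)) =
        pd c' * (ind (c = c'(i := c i)) * cond K pd c' i (c i))" for i
    proof (cases "c' = c(i := c' i)")
      case True
      then have "c = c'(i := c i)" by (metis fun_upd_triv fun_upd_upd)
      moreover have "c(i := j) = c'(i := j)" for j using True by (metis fun_upd_upd)
      ultimately show ?thesis using True by (simp add: cond_def ind_def)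
    next
      case False
      then have "c \<noteq> c'(i := c i)" by (metis fun_upd_triv fun_upd_upd)
      then show ?thesis using False by (simp add: ind_def)
    qed
    then show ?thesis by (simp add: P_MG_def sum_distrib_left mult.left_commute[of "pd _"])
  qed
  have bal': "pd c * P_MG_full c c' = pd c' * P_MG_full c' c" for c c'
    using bal[of c c'] by (auto simp: P_MG_full_def ind_def)
  show ?thesis
  proof
    fix c c' assume "c \<in> C" "c' \<in> C"
    then show "P_MG_full c c' \<ge> 0"
      unfolding P_MG_full_def P_MG_def
      by (auto intro!: sum_nonneg divide_nonneg_nonneg mult_nonneg_nonneg ind_nonneg cond_nonneg dest: C_val)
  next
    fix c' assume c': "c' \<in> C"
    show "(\<Sum>c\<in>C. pd c * P_MG_full c c') = pd c'"
      unfolding bal'[of _ c'] by (simp add: sum_distrib_left[symmetric] row c')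
  qed (auto simp: finite_C pd_nonneg pd_total bal' row)
qed

text \<open>In the constant, 2 undoes the random orientation and \<open>K - 1\<close> the
  normalization of the pair weights. What remains is a proposal of item \<open>i\<close> with weight
  \<open>(a + b) / a\<close> relative to the uniform choice of \<open>P_MG\<close>, and this excess
  has to pay for the acceptance probability.\<close>

lemma P_MG_le_P_R:
  assumes c: "c \<in> C" "c' \<in> C" and pos: "pd c \<noteq> 0" and ne: "c \<noteq> c'"
  shows "P_MG K n pd c c' \<le> 2 * (real K - 1) * P_R K n pd c c'"
proof (cases "\<exists>i\<in>{1..n}. c' = c(i := c' i)")
  case False
  then have "P_MG K n pd c c' = 0" by (auto simp: P_MG_def ind_def)
  moreover have "P_R K n pd c c' \<ge> 0"
    using c P_R_reversible by (auto simp: reversible_chain_def stationary_chain_def)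
  ultimately show ?thesis using K2 by simp
next
  case True
  then obtain i where i: "i \<in> {1..n}" and c': "c' = c(i := c' i)" by auto
  define km kp where "km = c i" "kp = c' i"
  note kdef = km_kp_def
  have neq: "km \<noteq> kp" using c' ne kdef by (metis fun_upd_triv)
  have k: "km \<in> {1..K}" "kp \<in> {1..K}" using C_val[OF c(1) i] C_val[OF c(2) i] kdef by auto
  define A B where "A = cond K pd c i km" "B = cond K pd c i kp"
  have pos': "pd c > 0" using pos pd_nonneg[OF c(1)] by simp
  have "0 < pd c / (\<Sum>j\<in>{1..K}. pd (c(i := j)))"
    using pos' normalizer_ge[OF c(1) i k(1)] by (intro divide_pos_pos) (auto simp: kdef)
  then have "A > 0" by (simp add: A_B_def cond_def kdef)
  moreover have "A \<le> 1" "B \<ge> 0" "B \<le> 1"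
    using cond_le_1[OF c(1) i] cond_nonneg[OF c(1) i] k by (auto simp: A_B_def)
  ultimately have AB: "A > 0" "A \<le> 1" "B \<ge> 0" "B \<le> 1" by auto
  define a b where "a = real (ncount n c km)" "b = real (ncount n c kp)"
  have ab: "a \<ge> 1" "b \<ge> 0" using ncount_pos[OF i, of c] by (auto simp: a_b_def kdef)
  have "(\<Sum>j\<in>{1..n}. ind (c' = c(j := c' j)) * cond K pd c j (c' j)) =
      (\<Sum>j\<in>{1..n}. if j = i then B else 0)"
  proof (intro sum.cong refl)
    fix j
    have "c' \<noteq> c(j := c' j)" if "j \<noteq> i" using that neq kdef by (metis fun_upd_other)
    then show "ind (c' = c(j := c' j)) * cond K pd c j (c' j) = (if j = i then B else 0)"
      using c' by (auto simp: ind_def A_B_def kdef)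
  qed
  then have MG: "P_MG K n pd c c' = B / real n"
    using i by (simp add: P_MG_def)
  have "1 / a * acc K n pd c i km kp * ind (c' = c(i := kp)) \<le> move K n pd c km kp c'"
    unfolding move_def a_b_def
  proof (rule member_le_sum)
    fix j assume "j \<in> {j \<in> {1..n}. c j = km} - {i}"
    then show "0 \<le> 1 / real (ncount n c km) * acc K n pd c j km kp * ind (c' = c(j := kp))"
      by (intro mult_nonneg_nonneg acc_nonneg c k ind_nonneg) auto
  qed (use i kdef in auto)
  then have "1 / a * acc K n pd c i km kp \<le> move K n pd c km kp c'"
    using c' by (simp add: ind_def kdef)
  also have "\<dots> \<le> R_step K n pd c km kp c'"
    using reject_nonneg ind_nonneg by (simp add: R_step_move)
  finally have step: "1 / a * acc K n pd c i km kp \<le> R_step K n pd c km kp c'" .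
  let ?F = "\<lambda>k k'. pc K n c k k' * (1/2 * R_step K n pd c k k' c' + 1/2 * R_step K n pd c k' k c')"
  have F_nonneg: "?F k k' \<ge> 0" if "(k, k') \<in> KP" for k k'
    using KP_mem[OF that] by (intro mult_nonneg_nonneg add_nonneg_nonneg pc_nonneg R_step_nonneg c) auto
  have mem: "?F k k' \<le> P_R K n pd c c'" if "(k, k') \<in> KP" for k k'
    unfolding P_R_def using member_le_sum[OF that, of "\<lambda>(k, k'). ?F k k'"] F_nonneg finite_KP by auto
  have "?F km kp \<le> P_R K n pd c c'"
  proof (cases "km < kp")
    case True
    then show ?thesis using k by (intro mem) (auto simp: Kpairs_def)
  next
    case False
    then have "?F kp km \<le> P_R K n pd c c'" using k neq by (intro mem) (auto simp: Kpairs_def)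
    then show ?thesis by (simp add: pc_commute[of _ kp km] add.commute)
  qed
  moreover have "pc K n c km kp * (1/2 * (1 / a * acc K n pd c i km kp)) \<le> ?F km kp"
    using step R_step_nonneg[OF c(1) k(2) k(1), of c'] by (intro mult_left_mono pc_nonneg) auto
  ultimately have PR: "pc K n c km kp * (1/2 * (1 / a * acc K n pd c i km kp)) \<le> P_R K n pd c c'"
    by linarith
  have acc: "acc K n pd c i km kp = min 1 (a / (b + 1) * (B / A))"
    by (simp add: acc_def ratio_def a_b_def A_B_def add.commute)
  \<comment> \<open>If the proposal is always accepted, \<open>B \<le> 1\<close> suffices. Otherwise
    the factor \<open>a\<close> cancels, and \<open>a \<ge> 1\<close> gives
    \<open>(a + b) / (b + 1) \<ge> 1\<close>, while \<open>A \<le> 1\<close> gives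
    \<open>B \<le> B / A\<close>.\<close>
  have "B \<le> (a + b) / a * min 1 (a / (b + 1) * (B / A))"
  proof (cases "1 \<le> a / (b + 1) * (B / A)")
    case True
    have "1 \<le> (a + b) / a" using ab by simp
    then show ?thesis using True AB by simp
  next
    case False
    have "B \<le> B / A" using AB by (simp add: le_divide_eq mult_left_le)
    also have "\<dots> \<le> (a + b) / (b + 1) * (B / A)"
      using ab AB mult_right_mono[of 1 "(a + b) / (b + 1)" "B / A"] by simp
    also have "\<dots> = (a + b) / a * (a / (b + 1) * (B / A))" using ab by simp
    finally show ?thesis using False by simp
  qed
  then have "B / real n \<le> (a + b) / a * acc K n pd c i km kp / real n"
    unfolding acc by (intro divide_right_mono) auto
  also have "\<dots> = 2 * (real K - 1) * (pc K n c km kp * (1/2 * (1 / a * acc K n pd c i km kp)))"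
    using K2 n1 ab by (simp add: pc_def a_b_def[symmetric] of_nat_diff field_simps)
  also have "\<dots> \<le> 2 * (real K - 1) * P_R K n pd c c'"
    using K2 PR by (intro mult_left_mono) auto
  finally show ?thesis unfolding MG .
qed

text \<open>Diagonal terms of the Dirichlet sums vanish, so the off-diagonal kernel bound compares
  the energies term by term.\<close>

lemma P_R_le_P_MG:
  "asym_var C pd (P_R K n pd) g \<le>
    ereal (2 * (real K - 1)) * asym_var C pd (P_MG K n pd) g
    + ereal ((2 * (real K - 1) - 1) * var_dist C pd g)"
proof -
  interpret R: reversible_chain C pd "P_R K n pd" by (rule P_R_reversible)
  interpret M: reversible_chain C pd P_MG_full by (rule P_MG_reversible)
  have "ip C pd u u - ip C pd u (kstep C P_MG_full u)
      \<le> 2 * (real K - 1) * (ip C pd u u - ip C pd u (kstep C (P_R K n pd) u))" for u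
  proof -
    have "(\<Sum>x\<in>C. \<Sum>y\<in>C. pd x * P_MG_full x y * (u x - u y)\<^sup>2) \<le>
        (\<Sum>x\<in>C. \<Sum>y\<in>C. 2 * (real K - 1) * (pd x * P_R K n pd x y * (u x - u y)\<^sup>2))"
    proof (intro sum_mono)
      fix x y assume xy: "x \<in> C" "y \<in> C"
      show "pd x * P_MG_full x y * (u x - u y)\<^sup>2 \<le> 2 * (real K - 1) * (pd x * P_R K n pd x y * (u x - u y)\<^sup>2)"
      proof (cases "pd x = 0 \<or> x = y")
        case False
        then have "P_MG_full x y \<le> 2 * (real K - 1) * P_R K n pd x y"
          using P_MG_le_P_R[OF xy] by (simp add: P_MG_full_def)
        then have "pd x * P_MG_full x y * (u x - u y)\<^sup>2 \<le> pd x * (2 * (real K - 1) * P_R K n pd x y) * (u x - u y)\<^sup>2"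
          using pd_nonneg[OF xy(1)] by (intro mult_right_mono mult_left_mono) auto
        then show ?thesis by (simp only: mult_ac)
      qed auto
    qed
    then show ?thesis unfolding M.dirichlet R.dirichlet by (simp add: sum_distrib_left)
  qed
  then have "asym_var C pd (P_R K n pd) g \<le>
    ereal (2 * (real K - 1)) * asym_var C pd P_MG_full g + ereal ((2 * (real K - 1) - 1) * var_dist C pd g)"
    using asym_var_comparison[OF R.stationary_chain_axioms P_MG_reversible, of "2 * (real K - 1)" "\<lambda>x. x" "\<lambda>u. u" g] K2
    by simp
  then show ?thesis by (simp add: asym_var_P_MG_full)
qed

end

section \<open>The non-reversible kernel\<close>

lemma vneg_apply: "p \<in> Kpairs K \<Longrightarrow> vneg K v p = - v p"
  by (simp add: vneg_def)

lemma vneg_vneg: "v \<in> velocities K \<Longrightarrow> vneg K (vneg K v) = v"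
  by (auto simp: velocities_def vneg_def PiE_def extensional_def fun_eq_iff)

lemma vneg_mem: "v \<in> velocities K \<Longrightarrow> vneg K v \<in> velocities K"
  by (auto simp: velocities_def vneg_def)

lemma bij_vneg: "bij_betw (vneg K) (velocities K) (velocities K)"
  by (rule bij_betw_byWitness[where f' = "vneg K"]) (auto simp: vneg_vneg vneg_mem)

lemma sum_vneg: "(\<Sum>v\<in>velocities K. f (vneg K v)) = (\<Sum>v\<in>velocities K. f v)"
  by (rule sum.reindex_bij_betw[OF bij_vneg])

lemma vflip_mem: "v \<in> velocities K \<Longrightarrow> p \<in> Kpairs K \<Longrightarrow> vflip p v \<in> velocities K"
  by (auto simp: velocities_def vflip_def PiE_def extensional_def Pi_def)

lemma vflip_vflip: "vflip p (vflip p v) = v"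
  by (simp add: vflip_def)

lemma vflip_vneg: "p \<in> Kpairs K \<Longrightarrow> vflip p (vneg K v) = vneg K (vflip p v)"
  by (auto simp: vflip_def vneg_def fun_eq_iff)

lemma eq_vflip_vneg_iff:
  assumes "v \<in> velocities K" "w \<in> velocities K" "p \<in> Kpairs K"
  shows "vneg K v = vflip p (vneg K w) \<longleftrightarrow> w = vflip p v"
  by (metis assms vflip_vflip vflip_vneg vneg_vneg vflip_mem)

lemma vneg_eq_iff:
  "v \<in> velocities K \<Longrightarrow> w \<in> velocities K \<Longrightarrow> vneg K v = vneg K w \<longleftrightarrow> w = v"
  by (metis vneg_vneg)

lemma velocity_cases: "v \<in> velocities K \<Longrightarrow> p \<in> Kpairs K \<Longrightarrow> v p = 1 \<or> v p = -1"
  by (auto simp: velocities_def)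

lemma flip_kernel_vneg:
  assumes "v \<in> velocities K" "w \<in> velocities K" "p \<in> Kpairs K"
  shows "flip_kernel p q (vneg K w) (vneg K v) = flip_kernel p q v w"
  using eq_vflip_vneg_iff[OF assms] vneg_eq_iff[OF assms(1,2)] by (simp add: flip_kernel_def)

text \<open>A component takes only the values 1 and -1, so a function of it is a constant plus an
  odd function, and the odd part is invisible to an even \<open>e\<close>.\<close>

lemma sum_velocity_component:
  assumes p: "p \<in> Kpairs K"
    and even: "\<And>v. v \<in> velocities K \<Longrightarrow> e (vneg K v) = e v"
  shows "(\<Sum>v\<in>velocities K. f (v p) * e v) = (f 1 + f (-1)) / 2 * (\<Sum>v\<in>velocities K. (e v :: real))"
proof -
  have "(\<Sum>v\<in>velocities K. f (v p) * e v) = (\<Sum>v\<in>velocities K. f (- v p) * e v)"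
    by (subst sum_vneg[symmetric]) (intro sum.cong refl, simp add: vneg_apply[OF p] even)
  then have "2 * (\<Sum>v\<in>velocities K. f (v p) * e v) = (\<Sum>v\<in>velocities K. f (v p) * e v + f (- v p) * e v)"
    by (simp add: sum.distrib)
  also have "\<dots> = (\<Sum>v\<in>velocities K. (f 1 + f (-1)) * e v)"
  proof (intro sum.cong refl)
    fix v assume "v \<in> velocities K"
    from velocity_cases[OF this p] show "f (v p) * e v + f (- v p) * e v = (f 1 + f (-1)) * e v"
      by (auto simp: algebra_simps)
  qed
  finally show ?thesis by (simp add: sum_distrib_left[symmetric])
qed

context mixture_posterior
begin

lemma NR_core_nonneg:
  assumes "c \<in> C" "(k, k') \<in> KP"
  shows "NR_core K n pd k k' (c, v) (c', v') \<ge> 0"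
  using assms KP_mem[OF assms(2)]
  by (auto simp: NR_core_move Let_def vel_from_def
      intro!: add_nonneg_nonneg mult_nonneg_nonneg move_nonneg reject_nonneg ind_nonneg)

lemma flip_kernel_nonneg: "flip_kernel p q v w \<ge> 0"
  unfolding flip_kernel_def using q01 by (intro add_nonneg_nonneg mult_nonneg_nonneg ind_nonneg) auto

lemma sum_flip_kernel:
  assumes "v \<in> V" "p \<in> KP"
  shows "(\<Sum>w\<in>V. flip_kernel p q v w * f w) = (1 - q) * f v + q * f (vflip p v)"
proof -
  have "(\<Sum>w\<in>V. flip_kernel p q v w * f w) =
      (1 - q) * (\<Sum>w\<in>V. ind (w = v) * f w) + q * (\<Sum>w\<in>V. ind (w = vflip p v) * f w)"
    by (simp only: flip_kernel_def distrib_right sum.distrib sum_distrib_left mult.assoc)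
  then show ?thesis by (simp only: sum_ind finite_V vflip_mem assms)
qed

text \<open>Negating the velocity exchanges the labels left and entered, so moves reduce to
  \<open>move_balance\<close>. After a rejection the component has been flipped, and negating it
  restores the original sign: the reversed step has the same rejection probability at the same
  configuration.\<close>

lemma NR_core_balance:
  assumes c: "c \<in> C" "c' \<in> C" and v: "v \<in> V" "v' \<in> V" and p: "(k, k') \<in> KP"
  shows "pd c * (pc K n c k k' * NR_core K n pd k k' (c, v) (c', v')) =
    pd c' * (pc K n c' k k' * NR_core K n pd k k' (c', neg v') (c, neg v))"
proof -
  define km kp where "km = vel_from (k, k') (v (k, k'))" and "kp = vel_from (k', k) (v (k, k'))"
  have k: "km \<in> {1..K}" "kp \<in> {1..K}" "km \<noteq> kp"
    using KP_mem[OF p] by (auto simp: km_def kp_def vel_from_def)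
  have pcm: "pc K n x km kp = pc K n x k k'" for x
    by (auto simp: km_def kp_def vel_from_def pc_commute)
  have vflip_at: "vflip (k, k') v (k, k') = - v (k, k')" by (simp add: vflip_def)
  have L: "NR_core K n pd k k' (c, v) (c', v') = move K n pd c km kp c' * ind (v' = v)
      + reject K n pd c km kp * ind (c' = c) * ind (v' = vflip (k, k') v)"
    by (simp add: NR_core_move km_def kp_def Let_def)
  have neg1: "vel_from (k, k') (neg v (k, k')) = kp" "vel_from (k', k) (neg v (k, k')) = km"
    using velocity_cases[OF v(1) p] by (auto simp: vneg_apply[OF p] km_def kp_def vel_from_def)
  have R: "NR_core K n pd k k' (c', neg v') (c, neg v) = move K n pd c' kp km c * ind (v' = v)
      + reject K n pd c km kp * ind (c' = c) * ind (v' = vflip (k, k') v)"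
  proof -
    define km' kp' where "km' = vel_from (k, k') (neg v' (k, k'))" and "kp' = vel_from (k', k) (neg v' (k, k'))"
    have "NR_core K n pd k k' (c', neg v') (c, neg v) = move K n pd c' km' kp' c * ind (v' = v)
      + reject K n pd c' km' kp' * ind (c = c') * ind (v' = vflip (k, k') v)"
      unfolding NR_core_move Let_def km'_def[symmetric] kp'_def[symmetric]
      by (simp only: vneg_eq_iff[OF v] eq_vflip_vneg_iff[OF v p])
    moreover have "move K n pd c' km' kp' c * ind (v' = v) = move K n pd c' kp km c * ind (v' = v)"
      by (cases "v' = v") (simp_all add: km'_def kp'_def neg1 ind_def)
    moreover have "reject K n pd c' km' kp' * ind (c = c') * ind (v' = vflip (k, k') v) =
        reject K n pd c km kp * ind (c' = c) * ind (v' = vflip (k, k') v)"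
      by (cases "v' = vflip (k, k') v \<and> c' = c")
        (auto simp: km'_def kp'_def km_def kp_def vneg_apply[OF p] vflip_at ind_def)
    ultimately show ?thesis by simp
  qed
  have "pd c * (pc K n c k k' * (reject K n pd c km kp * ind (c' = c) * ind (v' = vflip (k, k') v))) =
      pd c' * (pc K n c' k k' * (reject K n pd c km kp * ind (c' = c) * ind (v' = vflip (k, k') v)))"
    by (cases "c' = c") (simp_all add: ind_def)
  moreover have "pd c * (pc K n c k k' * (move K n pd c km kp c' * ind (v' = v))) =
      pd c' * (pc K n c' k k' * (move K n pd c' kp km c * ind (v' = v)))"
    using arg_cong[OF move_balance[OF c k], of "\<lambda>t. t * ind (v' = v)"] by (simp add: pcm mult.assoc)
  ultimately show ?thesis unfolding L R by (simp only: distrib_left)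
qed

text \<open>The composition flip, core, flip reads the same in both directions: reversal swaps the
  two flips, which is why refreshment occurs on both sides of the core step.\<close>

lemma P_tilde_balance:
  assumes c: "c \<in> C" "c' \<in> C" and v: "v \<in> V" "v' \<in> V" and p: "(k, k') \<in> KP"
  shows "pd c * (pc K n c k k' * P_tilde K n pd xi k k' (c, v) (c', v')) =
    pd c' * (pc K n c' k k' * P_tilde K n pd xi k k' (c', neg v') (c, neg v))"
proof -
  let ?F = "flip_kernel (k, k') q"
  let ?N = "NR_core K n pd k k'"
  have "pd c' * (pc K n c' k k' * P_tilde K n pd xi k k' (c', neg v') (c, neg v)) =
    (\<Sum>u1\<in>V. \<Sum>u2\<in>V. ?F (neg v') u1 * (pd c' * (pc K n c' k k' * ?N (c', u1) (c, u2))) * ?F u2 (neg v))"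
    by (simp add: P_tilde_def sum_distrib_left mult_ac)
  \<comment> \<open>The reversed path visits the negated intermediate velocities in opposite order,
    so \<open>u1\<close> becomes \<open>neg w2\<close> and \<open>u2\<close> becomes
    \<open>neg w1\<close>.\<close>
  also have "\<dots> = (\<Sum>w2\<in>V. \<Sum>w1\<in>V.
      ?F (neg v') (neg w2) * (pd c' * (pc K n c' k k' * ?N (c', neg w2) (c, neg w1))) * ?F (neg w1) (neg v))"
    by (subst sum_vneg[symmetric], subst (2) sum_vneg[symmetric]) (rule refl)
  also have "\<dots> = (\<Sum>w2\<in>V. \<Sum>w1\<in>V.
      ?F w2 v' * (pd c * (pc K n c k k' * ?N (c, w1) (c', w2))) * ?F v w1)"
    using v p by (intro sum.cong refl) (simp only: NR_core_balance[OF c _ _ p, symmetric] flip_kernel_vneg)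
  also have "\<dots> = pd c * (pc K n c k k' * P_tilde K n pd xi k k' (c, v) (c', v'))"
    by (subst sum.swap) (simp add: P_tilde_def sum_distrib_left mult_ac)
  finally show ?thesis ..
qed

section \<open>The extended chain: stationarity, skew symmetry and velocity averages\<close>

abbreviation "E \<equiv> C \<times> V"
abbreviation "mu \<equiv> pi_ext K pd"
abbreviation "P \<equiv> P_NR K n pd xi"

definition sneg :: "config \<times> velocity \<Rightarrow> config \<times> velocity" where
  "sneg s = (fst s, neg (snd s))"

lemma sneg_mem: "s \<in> E \<Longrightarrow> sneg s \<in> E"
  by (auto simp: sneg_def vneg_mem)

lemma sneg_sneg: "s \<in> E \<Longrightarrow> sneg (sneg s) = s"
  by (auto simp: sneg_def vneg_vneg)

lemma sum_sneg: "(\<Sum>s\<in>E. f (sneg s)) = (\<Sum>s\<in>E. f s)"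
proof (rule sum.reindex_bij_betw, rule bij_betw_byWitness[where f' = sneg])
qed (use sneg_mem sneg_sneg in blast)+

lemma mu_sneg: "mu (sneg s) = mu s"
  by (simp add: pi_ext_def sneg_def)

lemma skew_balance:
  assumes "s \<in> E" "s' \<in> E"
  shows "mu s * P s s' = mu s' * P (sneg s') (sneg s)"
proof -
  have "pd (fst s) * P s s' = pd (fst s') * P (sneg s') (sneg s)"
    unfolding P_NR_def sum_distrib_left using assms P_tilde_balance
    by (intro sum.cong refl) (auto simp: sneg_def)
  then show ?thesis by (simp add: pi_ext_def)
qed

lemma sum_E: "(\<Sum>s\<in>E. f s) = (\<Sum>c\<in>C. \<Sum>v\<in>V. f (c, v))"
  by (simp add: sum.cartesian_product)

lemma sum_NR_core: "v \<in> V \<Longrightarrow> (k, k') \<in> KP \<Longrightarrow> (\<Sum>w\<in>V. NR_core K n pd k k' (c, v) (c', w)) =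
    R_step K n pd c (vel_from (k, k') (v (k, k'))) (vel_from (k', k) (v (k, k'))) c'"
  by (simp add: NR_core_move Let_def sum.distrib sum_distrib_left[symmetric] sum_ind(3) finite_V vflip_mem R_step_move)

text \<open>On functions of the configuration alone, the second flip is invisible and \<open>P_tilde\<close> for the
  pair \<open>p\<close> depends on the velocity through its component \<open>p\<close> only.\<close>

definition R_half :: "(config \<Rightarrow> real) \<Rightarrow> config \<Rightarrow> nat \<times> nat \<Rightarrow> int \<Rightarrow> real" where
  "R_half a c p s = (\<Sum>c'\<in>C. R_step K n pd c (vel_from p s) (vel_from (prod.swap p) s) c' * a c')"

lemma P_tilde_config_function:
  assumes v: "v \<in> V" and p: "(k, k') \<in> KP"
  shows "(\<Sum>s'\<in>E. P_tilde K n pd xi k k' (c, v) s' * a (fst s')) =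
    (1 - q) * R_half a c (k, k') (v (k, k')) + q * R_half a c (k, k') (- v (k, k'))"
proof -
  let ?F = "flip_kernel (k, k') q"
  let ?N = "NR_core K n pd k k'"
  have "(\<Sum>v'\<in>V. P_tilde K n pd xi k k' (c, v) (c', v')) =
      (\<Sum>w1\<in>V. ?F v w1 * R_step K n pd c (vel_from (k, k') (w1 (k, k'))) (vel_from (k', k) (w1 (k, k'))) c')"
    for c'
  proof -
    have "(\<Sum>v'\<in>V. P_tilde K n pd xi k k' (c, v) (c', v')) =
        (\<Sum>w1\<in>V. \<Sum>v'\<in>V. \<Sum>w2\<in>V. ?F v w1 * ?N (c, w1) (c', w2) * ?F w2 v')"
      unfolding P_tilde_def fst_conv snd_conv by (rule sum.swap)
    also have "\<dots> = (\<Sum>w1\<in>V. \<Sum>w2\<in>V. \<Sum>v'\<in>V. ?F v w1 * ?N (c, w1) (c', w2) * ?F w2 v')"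
      by (intro sum.cong refl sum.swap)
    also have "\<dots> = (\<Sum>w1\<in>V. \<Sum>w2\<in>V. ?F v w1 * ?N (c, w1) (c', w2))"
      using sum_flip_kernel[OF _ p, of _ "\<lambda>_. 1"] by (intro sum.cong refl) (simp add: sum_distrib_left[symmetric])
    also have "\<dots> = (\<Sum>w1\<in>V. ?F v w1 * R_step K n pd c (vel_from (k, k') (w1 (k, k'))) (vel_from (k', k) (w1 (k, k'))) c')"
      by (intro sum.cong refl) (simp add: sum_distrib_left[symmetric] sum_NR_core p)
    finally show ?thesis .
  qed
  then have "(\<Sum>s'\<in>E. P_tilde K n pd xi k k' (c, v) s' * a (fst s')) =
      (\<Sum>c'\<in>C. \<Sum>w1\<in>V. ?F v w1 * R_step K n pd c (vel_from (k, k') (w1 (k, k'))) (vel_from (k', k) (w1 (k, k'))) c' * a c')"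
    unfolding sum_E fst_conv by (simp add: sum_distrib_right[symmetric])
  also have "\<dots> = (\<Sum>w1\<in>V. ?F v w1 * R_half a c (k, k') (w1 (k, k')))"
    by (subst sum.swap) (simp add: R_half_def sum_distrib_left mult.assoc)
  also have "\<dots> = (1 - q) * R_half a c (k, k') (v (k, k')) + q * R_half a c (k, k') (vflip (k, k') v (k, k'))"
    by (rule sum_flip_kernel[OF v p])
  finally show ?thesis by (simp add: vflip_def)
qed

definition refreshed :: "(config \<Rightarrow> real) \<Rightarrow> config \<Rightarrow> nat \<times> nat \<Rightarrow> int \<Rightarrow> real" where
  "refreshed a c p s = (1 - q) * R_half a c p s + q * R_half a c p (- s)"

lemma P_config_function:
  assumes "v \<in> V"
  shows "kstep E P (\<lambda>s. a (fst s)) (c, v) = (\<Sum>(k, k')\<in>KP. pc K n c k k' * refreshed a c (k, k') (v (k, k')))"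
proof -
  have "kstep E P (\<lambda>s. a (fst s)) (c, v) =
      (\<Sum>(k, k')\<in>KP. pc K n c k k' * (\<Sum>s'\<in>E. P_tilde K n pd xi k k' (c, v) s' * a (fst s')))"
    unfolding kstep_def P_NR_def split_def fst_conv sum_distrib_left sum_distrib_right mult.assoc
    by (rule sum.swap)
  also have "\<dots> = (\<Sum>(k, k')\<in>KP. pc K n c k k' * refreshed a c (k, k') (v (k, k')))"
    using P_tilde_config_function[OF assms] by (intro sum.cong refl) (auto simp: refreshed_def)
  finally show ?thesis .
qed

text \<open>Summed over both signs, the weights \<open>1 - q\<close> and \<open>q\<close> add up to
  1, so the refresh parameter disappears and one reversible kernel serves every
  \<open>xi\<close>.\<close>

lemma P_R_config_function:
  "kstep C (P_R K n pd) a c =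
    (\<Sum>(k, k')\<in>KP. pc K n c k k' * ((refreshed a c (k, k') 1 + refreshed a c (k, k') (-1)) / 2))"
proof -
  have "kstep C (P_R K n pd) a c = (\<Sum>(k, k')\<in>KP. \<Sum>c'\<in>C. pc K n c k k' *
      ((1/2) * R_step K n pd c k k' c' + (1/2) * R_step K n pd c k' k c') * a c')"
    unfolding kstep_def P_R_def split_def sum_distrib_right by (rule sum.swap)
  also have "\<dots> = (\<Sum>(k, k')\<in>KP. pc K n c k k' * ((R_half a c (k, k') 1 + R_half a c (k, k') (-1)) / 2))"
    by (intro sum.cong refl)
      (auto simp: R_half_def vel_from_def sum.distrib[symmetric] sum_distrib_left sum_divide_distrib algebra_simps
        add_divide_distrib intro!: sum.cong)
  also have "\<dots> = (\<Sum>(k, k')\<in>KP. pc K n c k k' * ((refreshed a c (k, k') 1 + refreshed a c (k, k') (-1)) / 2))"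
    by (intro sum.cong refl) (auto simp: refreshed_def algebra_simps)
  finally show ?thesis .
qed

lemma P_NR_stationary: "stationary_chain E mu P"
proof -
  have row: "(\<Sum>s'\<in>E. P s s') = 1" if s: "s \<in> E" for s
  proof -
    obtain c v where cv: "s = (c, v)" "c \<in> C" "v \<in> V" using s by auto
    have "refreshed (\<lambda>_. 1) c (k, k') (v (k, k')) = 1" if "(k, k') \<in> KP" for k k'
      using KP_mem[OF that] by (simp add: refreshed_def R_half_def vel_from_def R_step_row_sum[OF cv(2)])
    then have "kstep E P (\<lambda>_. 1) (c, v) = (\<Sum>(k, k')\<in>KP. pc K n c k k')"
      unfolding P_config_function[OF cv(3), of "\<lambda>_. 1"] by (intro sum.cong refl) auto
    then show ?thesis using pc_total[OF cv(2)] cv by (simp add: kstep_def)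
  qed
  show ?thesis
  proof
    show "finite E" by (simp add: finite_C finite_V)
    show "mu s \<ge> 0" if "s \<in> E" for s using that by (auto simp: pi_ext_def pd_nonneg)
    show "P s s' \<ge> 0" if "s \<in> E" "s' \<in> E" for s s'
      unfolding P_NR_def P_tilde_def using that
      by (auto intro!: sum_nonneg mult_nonneg_nonneg pc_nonneg flip_kernel_nonneg NR_core_nonneg)
    show "(\<Sum>s'\<in>E. P s s') = 1" if "s \<in> E" for s by (rule row[OF that])
    show "(\<Sum>s\<in>E. mu s * P s s') = mu s'" if s': "s' \<in> E" for s'
    proof -
      have "(\<Sum>s\<in>E. mu s * P s s') = (\<Sum>s\<in>E. mu s' * P (sneg s') (sneg s))"
        by (intro sum.cong refl skew_balance s')
      also have "\<dots> = mu s' * (\<Sum>s\<in>E. P (sneg s') s)"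
        by (simp only: sum_distrib_left[symmetric] sum_sneg)
      finally show ?thesis using row[OF sneg_mem[OF s']] by simp
    qed
    show "(\<Sum>s\<in>E. mu s) = 1"
      unfolding sum_E by (simp add: pi_ext_def card_V pd_total)
  qed
qed

text \<open>In \<open>L\<^sup>2\<close> the adjoint of \<open>P_NR\<close> is its conjugate by
  \<open>sneg\<close>; this replaces self-adjointness and follows by reindexing both sums along
  \<open>sneg\<close>.\<close>

lemma skew_adjoint:
  "ip E mu f (kstep E P g) = ip E mu (\<lambda>s. g (sneg s)) (kstep E P (\<lambda>s. f (sneg s)))"
proof -
  let ?h = "\<lambda>s s'. mu s * P s s' * (f (sneg s') * g (sneg s))"
  have "ip E mu f (kstep E P g) = (\<Sum>s\<in>E. \<Sum>s'\<in>E. mu s * P s s' * (f s * g s'))"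
    by (simp add: ip_def kstep_def sum_distrib_left mult_ac)
  also have "\<dots> = (\<Sum>s\<in>E. \<Sum>s'\<in>E. ?h (sneg s') (sneg s))"
    by (intro sum.cong refl) (simp add: skew_balance sneg_sneg mu_sneg)
  also have "\<dots> = (\<Sum>s'\<in>E. \<Sum>s\<in>E. ?h s' s)"
  proof -
    have inner_sum: "(\<Sum>s\<in>E. ?h t (sneg s)) = (\<Sum>s\<in>E. ?h t s)" for t
      by (rule sum_sneg[of "?h t"])
    show ?thesis
      by (subst sum.swap, subst inner_sum) (rule sum_sneg[of "\<lambda>t. \<Sum>s\<in>E. ?h t s"])
  qed
  also have "\<dots> = ip E mu (\<lambda>s. g (sneg s)) (kstep E P (\<lambda>s. f (sneg s)))"
    by (simp add: ip_def kstep_def sum_distrib_left mult_ac)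
  finally show ?thesis .
qed

text \<open>The conditional expectation given the configuration, as velocities are uniform and
  independent of it under \<open>mu\<close>; hence the adjoint of composition with
  \<open>fst\<close>.\<close>

definition vavg :: "(config \<times> velocity \<Rightarrow> real) \<Rightarrow> config \<Rightarrow> real" where
  "vavg u c = (\<Sum>v\<in>V. u (c, v)) / 2 ^ card KP"

lemma ip_vavg: "ip E mu (\<lambda>s. F (fst s)) u = ip C pd F (vavg u)"
  by (simp add: ip_def sum_E pi_ext_def vavg_def sum_distrib_left sum_divide_distrib)

lemma vavg_P: "vavg (kstep E P (\<lambda>s. a (fst s))) c = kstep C (P_R K n pd) a c"
proof -
  have "(\<Sum>v\<in>V. kstep E P (\<lambda>s. a (fst s)) (c, v)) =
      (\<Sum>v\<in>V. \<Sum>(k, k')\<in>KP. pc K n c k k' * refreshed a c (k, k') (v (k, k')))"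
    by (intro sum.cong refl P_config_function)
  also have "\<dots> = (\<Sum>(k, k')\<in>KP. pc K n c k k' * (\<Sum>v\<in>V. refreshed a c (k, k') (v (k, k')) * 1))"
    unfolding split_def mult_1_right sum_distrib_left by (rule sum.swap)
  also have "\<dots> = (\<Sum>(k, k')\<in>KP. pc K n c k k' *
      (2 ^ card KP * ((refreshed a c (k, k') 1 + refreshed a c (k, k') (-1)) / 2)))"
  proof -
    have comp: "(\<Sum>v\<in>V. refreshed a c (k, k') (v (k, k')) * 1) =
        2 ^ card KP * ((refreshed a c (k, k') 1 + refreshed a c (k, k') (-1)) / 2)" if "(k, k') \<in> KP" for k k'
      using sum_velocity_component[OF that, of "\<lambda>_. 1"] by (simp add: card_V)
    show ?thesis by (intro sum.cong refl) (simp only: split_paired_all case_prod_conv comp)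
  qed
  also have "\<dots> = 2 ^ card KP * kstep C (P_R K n pd) a c"
    by (simp add: P_R_config_function sum_distrib_left split_def mult_ac)
  finally show ?thesis by (simp add: vavg_def)
qed

text \<open>For a fixed configuration, one step applied to a configuration function is a sum over
  pairs of functions of a single velocity component, and \<open>sum_velocity_component\<close>
  annihilates each against an even \<open>e\<close> of mean zero.\<close>

lemma P_config_orthogonal:
  assumes even: "\<And>c v. v \<in> V \<Longrightarrow> e (c, neg v) = e (c, v)"
    and mean: "\<And>c. (\<Sum>v\<in>V. e (c, v)) = 0"
  shows "ip E mu e (kstep E P (\<lambda>s. a (fst s))) = 0"
proof -
  have "(\<Sum>v\<in>V. e (c, v) * kstep E P (\<lambda>s. a (fst s)) (c, v)) = 0" for c
  proof -
    have "(\<Sum>v\<in>V. e (c, v) * kstep E P (\<lambda>s. a (fst s)) (c, v)) =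
        (\<Sum>v\<in>V. \<Sum>(k, k')\<in>KP. pc K n c k k' * (refreshed a c (k, k') (v (k, k')) * e (c, v)))"
      by (intro sum.cong refl) (simp add: P_config_function sum_distrib_left split_def mult_ac)
    also have "\<dots> = (\<Sum>(k, k')\<in>KP. pc K n c k k' * (\<Sum>v\<in>V. refreshed a c (k, k') (v (k, k')) * e (c, v)))"
      unfolding split_def sum_distrib_left by (rule sum.swap)
    also have "\<dots> = 0"
      by (intro sum.neutral) (auto simp: sum_velocity_component[where e = "\<lambda>v. e (c, v)"] even mean)
    finally show ?thesis .
  qed
  moreover have "ip E mu e (kstep E P (\<lambda>s. a (fst s))) =
      (\<Sum>c\<in>C. pd c / 2 ^ card KP * (\<Sum>v\<in>V. e (c, v) * kstep E P (\<lambda>s. a (fst s)) (c, v)))"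
    by (simp add: ip_def sum_E pi_ext_def sum_distrib_left)
  ultimately show ?thesis by simp
qed

text \<open>Write \<open>u = a + r\<close> with \<open>a\<close> the velocity average of \<open>u\<close>. The cross terms add up to the inner
  product of \<open>P a\<close> with \<open>r + r \<circ> sneg\<close>, which vanishes.\<close>

lemma vavg_energy_le:
  "ip C pd (vavg u) (vavg u) - ip C pd (vavg u) (kstep C (P_R K n pd) (vavg u)) \<le>
    ip E mu u u - ip E mu u (kstep E P u)"
proof -
  interpret stationary_chain E mu P by (rule P_NR_stationary)
  define A where "A = (\<lambda>s :: config \<times> velocity. vavg u (fst s))"
  define r where "r = (\<lambda>s. u s - A s)"
  have u: "u = (\<lambda>s. A s + r s)" by (simp add: r_def)
  have "vavg A c = vavg u c" for c
    unfolding vavg_def[of A] by (simp add: A_def card_V)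
  then have vavg_A: "vavg A = vavg u" ..
  have r0: "(\<Sum>v\<in>V. r (c, v)) = 0" for c
    by (simp add: r_def A_def sum_subtractf card_V) (simp add: vavg_def)
  then have vavg_r: "vavg r = (\<lambda>_. 0)" by (simp add: vavg_def fun_eq_iff)
  have AA: "ip E mu A A = ip C pd (vavg u) (vavg u)"
    using ip_vavg[of "vavg u" A] vavg_A by (simp add: A_def)
  have Ar: "ip E mu A r = 0"
    using ip_vavg[of "vavg u" r] by (simp add: A_def vavg_r ip_def)
  have APA: "ip E mu A (kstep E P A) = ip C pd (vavg u) (kstep C (P_R K n pd) (vavg u))"
    unfolding A_def ip_vavg by (simp add: vavg_P ip_def)
  \<comment> \<open>\<open>A\<close> ignores the velocity, hence is unchanged by
    \<open>sneg\<close>; both cross terms thus become pairings with the same function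
    \<open>kstep E P A\<close>.\<close>
  have "ip E mu A (kstep E P r) = ip E mu (\<lambda>s. r (sneg s)) (kstep E P A)"
    by (subst skew_adjoint) (simp add: A_def sneg_def)
  moreover have "ip E mu (\<lambda>s. r s + r (sneg s)) (kstep E P A) = 0"
    unfolding A_def
  proof (rule P_config_orthogonal)
    show "r (c, neg v) + r (sneg (c, neg v)) = r (c, v) + r (sneg (c, v))" if "v \<in> V" for c v
      using that by (simp add: sneg_def vneg_vneg)
    show "(\<Sum>v\<in>V. r (c, v) + r (sneg (c, v))) = 0" for c
      using r0[of c] sum_vneg[of "\<lambda>v. r (c, v)" K] by (simp add: sum.distrib sneg_def)
  qed
  ultimately have cross: "ip E mu A (kstep E P r) + ip E mu r (kstep E P A) = 0"
    by (simp add: ip_linear)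
  have "ip E mu u u - ip E mu u (kstep E P u) =
      (ip E mu A A - ip E mu A (kstep E P A)) + (ip E mu r r - ip E mu r (kstep E P r))"
    unfolding u using cross Ar ip_commute[of E mu r A] by (simp add: ip_linear kstep_linear)
  then show ?thesis using dirichlet_nonneg[of r] unfolding AA APA by simp
qed

lemma P_NR_le_P_R: "asym_var E mu P (\<lambda>s. g (fst s)) \<le> asym_var C pd (P_R K n pd) g"
proof -
  have "asym_var E mu P (\<lambda>s. g (fst s)) \<le>
      ereal 1 * asym_var C pd (P_R K n pd) g + ereal ((1 - 1) * var_dist C pd g)"
  proof (rule asym_var_comparison[OF P_NR_stationary P_R_reversible, where bar = vavg])
    show "(\<Sum>s\<in>E. mu s * F (fst s)) = (\<Sum>c\<in>C. pd c * F c)" for F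
      unfolding sum_E by (simp add: pi_ext_def card_V)
  qed (use vavg_energy_le in \<open>simp_all add: ip_vavg\<close>)
  then show ?thesis by simp
qed

end

theorem theorem1:
  fixes K n :: nat and pd :: "config \<Rightarrow> real" and xi :: real and g :: "config \<Rightarrow> real"
  assumes "K \<ge> 2" and "n \<ge> 1"
    and "\<forall>c\<in>configs K n. pd c \<ge> 0"
    and "(\<Sum>c\<in>configs K n. pd c) = 1"
    and "0 \<le> xi" and "xi \<le> real n"
  shows "asym_var (configs K n \<times> velocities K) (pi_ext K pd) (P_NR K n pd xi) (\<lambda>s. g (fst s))
           \<le> asym_var (configs K n) pd (P_R K n pd) g
       \<and> asym_var (configs K n) pd (P_R K n pd) g
           \<le> ereal (2 * (real K - 1)) * asym_var (configs K n) pd (P_MG K n pd) g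
             + ereal ((2 * (real K - 1) - 1) * var_dist (configs K n) pd g)"
proof -
  interpret mixture_posterior K n pd xi
    using assms by unfold_locales auto
  show ?thesis using P_NR_le_P_R P_R_le_P_MG by blast
qed

end
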